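(* Let $(y(s))_{s\in\mathbb N}$ be a family of $\varphi$-semicircular elements of $\mathcal A$, and let $\mathcal B$ be a subalgebra of $\mathcal A$ which contains $\mathcal D$ and such that the family $(\mathcal B,(\{y(s)\})_{s\in\mathbb N})$ is $\varphi$-free. Then the family $(\mathcal B,(\{y(s)\})_{s\in\mathbb N})$ is also free with amalgamation over $\mathcal D$, and the $\mathcal D$-distribution of each $y(s)$ is the $\mathcal D$-semicircular distribution with covariance $\varphi$.
   Context: $(\mathcal A,\varphi)$ is a tracial $*$-noncommutative probability space (unital complex $*$-algebra with tracial state) with self-adjoint nonzero pairwise orthogonal projections $p_1,\dots,p_d$, $p_1+\cdots+p_d=1$; $\rho_i=\varphi(p_i)\neq0$, $\mathcal D=\mathrm{Span}\{p_1,\dots,p_d\}$, $\varphi_i=\rho_i^{-1}\varphi|_{p_i\mathcal Ap_i}$, and $E:\mathcal A\to\mathcal D$, $E(x)=\sum_i\varphi_i(p_ixp_i)p_i$, is the conditional expectation onto $\mathcal D$. $\varphi$-freeness is ordinary freeness: subalgebras $(\mathcal A_i)_{i\in I}$ are $\varphi$-free if $\varphi(x(1)\cdots x(n))=0$ whenever $i_1\neq i_2\ne\cdots\ne i_n$ (consecutive indices distinct) and $x(j)\in\mathcal A_{i_j}\cap\ker\varphi$. Subalgebras $(\mathcal A_i)_{i\in I}$ all containing $\mathcal D$ are free with amalgamation over $\mathcal D$ if $E(x(1)\cdots x(n))=0$ whenever $i_1\ne\cdots\ne i_n$ (consecutive indices distinct) and $x(j)\in\mathcal A_{i_j}\cap\ker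 E$. A family of subsets $(\chi_i)$ is $\varphi$-free (resp. free with amalgamation over $\mathcal D$) if there are $\varphi$-free subalgebras (resp. subalgebras containing $\mathcal D$ and free with amalgamation over $\mathcal D$) $\mathcal A_i\supset\chi_i$. A $\varphi$-semicircular element is a self-adjoint element whose moments with respect to $\varphi$ are those of the semicircle distribution with center $0$ and radius $2$. The $\mathcal D$-distribution of a family $(a_i)$ is the map sending each word $X_{i_0}^{\epsilon_0}d_0\cdots X_{i_n}^{\epsilon_n}d_n$ ($d_j\in\mathcal D$, $\epsilon_j\in\{1,*\}$) to $E(a_{i_0}^{\epsilon_0}d_0\cdots a_{i_n}^{\epsilon_n}d_n)$. $\mathcal D$-valued cumulants $c_n:\mathcal A^{\otimes_{\mathcal D}n}\to\mathcal D$ are the $\mathcal D$-bimodule maps determined by $E(a_1\cdots a_n)=\sum_{\sigma\in NC(n)}c_\sigma(a_1\otimes\cdots\otimes a_n)$, where $NC(n)$ is the set of noncrossing partitions of $\{1,\dots,n\}$ and $c_\sigma$ is obtained by applying the $c_k$ to the blocks of $\sigma$ in the usual nested way. A self-adjoint $X$ is $\mathcal D$-semicircular with covariance $\varphi$ if $c_1(X)=0$, $c_2(Xd\otimes X)=\varphi(d)1$ for all $d\in\mathcal D$, and $c_k(Xd_1\otimes\cdots\otimes Xd_k)=0$ for all $k\ge3$, $d_1,\dots,d_k\in\mathcal D$; this determines its $\mathcal D$-distribution, called the $\mathcal D$-semicircular distribution with covariance $\varphi$. *)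

theory Defs
  imports "HOL-Analysis.Analysis" "HOL-Library.Disjoint_Sets"
begin

class complex_star_algebra = ring_1 +
  fixes scaleC :: "complex \<Rightarrow> 'a \<Rightarrow> 'a" (infixr "*\<^sub>C" 75)
    and star :: "'a \<Rightarrow> 'a"
  assumes scaleC_add_right: "c *\<^sub>C (x + y) = c *\<^sub>C x + c *\<^sub>C y"
    and scaleC_add_left: "(b + c) *\<^sub>C x = b *\<^sub>C x + c *\<^sub>C x"
    and scaleC_scaleC: "b *\<^sub>C c *\<^sub>C x = (b * c) *\<^sub>C x"
    and scaleC_one: "1 *\<^sub>C x = x"
    and mult_scaleC_left: "(c *\<^sub>C x) * y = c *\<^sub>C (x * y)"
    and mult_scaleC_right: "x * (c *\<^sub>C y) = c *\<^sub>C (x * y)"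
    and star_star: "star (star x) = x"
    and star_add: "star (x + y) = star x + star y"
    and star_scaleC: "star (c *\<^sub>C x) = cnj c *\<^sub>C star x"
    and star_mult: "star (x * y) = star y * star x"

global_interpretation star_alg: vector_space "scaleC :: complex \<Rightarrow> 'a \<Rightarrow> 'a::complex_star_algebra"
  by standard (simp_all add: scaleC_add_right scaleC_add_left scaleC_scaleC scaleC_one)

locale tracial_ncps =
  fixes \<phi> :: "'a::complex_star_algebra \<Rightarrow> complex"
  assumes state_add: "\<phi> (x + y) = \<phi> x + \<phi> y"
    and state_scaleC: "\<phi> (c *\<^sub>C x) = c * \<phi> x"
    and state_one: "\<phi> 1 = 1"
    and state_pos: "\<phi> (star x * x) \<in> \<real>\<^sub>\<ge>\<^sub>0"
    and state_trace: "\<phi> (x * y) = \<phi> (y * x)"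

locale projected_tracial_ncps = tracial_ncps \<phi>
  for \<phi> :: "'a::complex_star_algebra \<Rightarrow> complex" +
  fixes d :: nat and p :: "nat \<Rightarrow> 'a"
  assumes proj_selfadjoint: "i \<in> {1..d} \<Longrightarrow> star (p i) = p i"
    and proj_idem: "i \<in> {1..d} \<Longrightarrow> p i * p i = p i"
    and proj_nonzero: "i \<in> {1..d} \<Longrightarrow> p i \<noteq> 0"
    and proj_orth: "i \<in> {1..d} \<Longrightarrow> j \<in> {1..d} \<Longrightarrow> i \<noteq> j \<Longrightarrow> p i * p j = 0"
    and proj_sum: "(\<Sum>i = 1..d. p i) = 1"
    and rho_nonzero: "i \<in> {1..d} \<Longrightarrow> \<phi> (p i) \<noteq> 0"

definition diag :: "nat \<Rightarrow> (nat \<Rightarrow> 'a) \<Rightarrow> 'a::complex_star_algebra set" where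
  "diag d p = star_alg.span (p ` {1..d})"

text \<open>The state \<open>\<phi>\<^sub>i\<close>, meaningful on the corner \<open>p\<^sub>i \<A> p\<^sub>i\<close> only.\<close>

definition compressed_state ::
  "('a::complex_star_algebra \<Rightarrow> complex) \<Rightarrow> (nat \<Rightarrow> 'a) \<Rightarrow> nat \<Rightarrow> 'a \<Rightarrow> complex" where
  "compressed_state \<phi> p i x = inverse (\<phi> (p i)) * \<phi> x"

definition cond_exp ::
  "('a::complex_star_algebra \<Rightarrow> complex) \<Rightarrow> nat \<Rightarrow> (nat \<Rightarrow> 'a) \<Rightarrow> 'a \<Rightarrow> 'a" where
  "cond_exp \<phi> d p x = (\<Sum>i = 1..d. compressed_state \<phi> p i (p i * x * p i) *\<^sub>C p i)"


subsection \<open>Freeness\<close>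

text \<open>
  Subalgebras contain the unit of the ambient algebra but need not be closed under the involution.
\<close>

definition unital_subalgebra :: "'a::complex_star_algebra set \<Rightarrow> bool" where
  "unital_subalgebra A \<longleftrightarrow> 1 \<in> A \<and> (\<forall>x\<in>A. \<forall>y\<in>A. x + y \<in> A \<and> x * y \<in> A) \<and> (\<forall>c. \<forall>x\<in>A. c *\<^sub>C x \<in> A)"

definition alternating_vanish ::
  "('a::monoid_mult \<Rightarrow> 'b::zero) \<Rightarrow> ('i \<Rightarrow> 'a set) \<Rightarrow> bool" where
  "alternating_vanish F A \<longleftrightarrow>
     (\<forall>ks xs. ks \<noteq> [] \<and> distinct_adj ks \<and> list_all2 (\<lambda>k x. x \<in> A k \<and> F x = 0) ks xs
        \<longrightarrow> F (prod_list xs) = 0)"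

definition free_family ::
  "('a::complex_star_algebra \<Rightarrow> complex) \<Rightarrow> ('i \<Rightarrow> 'a set) \<Rightarrow> bool" where
  "free_family \<phi> \<Gamma> \<longleftrightarrow>
     (\<exists>A. (\<forall>i. unital_subalgebra (A i) \<and> \<Gamma> i \<subseteq> A i) \<and> alternating_vanish \<phi> A)"

definition amalgamated_free_family ::
  "('a::complex_star_algebra \<Rightarrow> complex) \<Rightarrow> nat \<Rightarrow> (nat \<Rightarrow> 'a) \<Rightarrow> ('i \<Rightarrow> 'a set) \<Rightarrow> bool" where
  "amalgamated_free_family \<phi> d p \<Gamma> \<longleftrightarrow>
     (\<exists>A. (\<forall>i. unital_subalgebra (A i) \<and> diag d p \<subseteq> A i \<and> \<Gamma> i \<subseteq> A i)
        \<and> alternating_vanish (cond_exp \<phi> d p) A)"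


subsection \<open>Scalar semicircular elements\<close>

text \<open>Semicircle distribution with center \<open>m\<close> and radius \<open>r\<close>.\<close>

definition semicircle :: "real \<Rightarrow> real \<Rightarrow> real measure" where
  "semicircle m r = density lborel
     (\<lambda>t. ennreal (indicator {m - r..m + r} t * (2 / (pi * r\<^sup>2)) * sqrt (r\<^sup>2 - (t - m)\<^sup>2)))"

definition semicircular :: "('a::complex_star_algebra \<Rightarrow> complex) \<Rightarrow> 'a \<Rightarrow> bool" where
  "semicircular \<phi> y \<longleftrightarrow>
     star y = y \<and> (\<forall>k::nat. \<phi> (y ^ k) = complex_of_real (\<integral>t. t ^ k \<partial>semicircle 0 2))"


subsection \<open>Operator-valued cumulants\<close>

text \<open>Positions in a word of length \<open>n\<close> are numbered \<open>0, \<dots>, n - 1\<close>, as in lists.\<close>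

definition noncrossing :: "nat set set \<Rightarrow> bool" where
  "noncrossing \<sigma> \<longleftrightarrow>
     (\<forall>V\<in>\<sigma>. \<forall>W\<in>\<sigma>. V \<noteq> W \<longrightarrow>
        \<not> (\<exists>i\<in>V. \<exists>j\<in>W. \<exists>k\<in>V. \<exists>l\<in>W. i < j \<and> j < k \<and> k < l))"

definition NC :: "nat \<Rightarrow> nat set set set" where
  "NC n = {\<sigma>. partition_on {..<n} \<sigma> \<and> noncrossing \<sigma>}"

definition first_block :: "nat set set \<Rightarrow> nat set \<Rightarrow> nat set" where
  "first_block \<sigma> S = {s \<in> S. \<exists>W\<in>\<sigma>. Min S \<in> W \<and> s \<in> W}"

text \<open>The positions of \<open>S\<close> strictly between \<open>v\<close> and the next element of the block \<open>V\<close>, or all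
  positions after \<open>v\<close> if \<open>v\<close> is the last element of \<open>V\<close>.\<close>

definition gap :: "nat set \<Rightarrow> nat set \<Rightarrow> nat \<Rightarrow> nat set" where
  "gap S V v = {s \<in> S. v < s \<and> (\<forall>w\<in>V. v < w \<longrightarrow> s < w)}"

lemma gap_psubset: "v \<in> S \<Longrightarrow> gap S V v \<subset> S"
  by (auto simp: gap_def)

lemma first_block_subset: "first_block \<sigma> S \<subseteq> S"
  by (auto simp: first_block_def)

text \<open>
  For a noncrossing \<open>\<sigma>\<close>, \<open>nested_cumulant c a \<sigma> {..<n}\<close> is
  \<open>c\<^sub>\<sigma> (a 0 \<otimes> \<cdots> \<otimes> a (n - 1))\<close>: if the block of \<open>\<sigma>\<close> containing the first position is
  \<open>v\<^sub>1 < \<cdots> < v\<^sub>k\<close>, and \<open>g\<^sub>j\<close> is the value obtained in the same way from the blocks of \<open>\<sigma>\<close> lying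
  in the gap after \<open>v\<^sub>j\<close>, the result is \<open>c\<^sub>k (a v\<^sub>1 g\<^sub>1 \<otimes> \<cdots> \<otimes> a v\<^sub>k g\<^sub>k)\<close>. The factor \<open>g\<^sub>k\<close> may
  equivalently be put to the right of \<open>c\<^sub>k\<close>, as \<open>c\<^sub>k\<close> is a bimodule map. Tensors of degree
  \<open>k\<close> are represented by lists of length \<open>k\<close>.
\<close>

function nested_cumulant ::
  "('a::monoid_mult list \<Rightarrow> 'a) \<Rightarrow> (nat \<Rightarrow> 'a) \<Rightarrow> nat set set \<Rightarrow> nat set \<Rightarrow> 'a" where
  "nested_cumulant c a \<sigma> S =
     (if finite S \<and> S \<noteq> {}
      then c (map (\<lambda>v. a v * nested_cumulant c a \<sigma> (gap S (first_block \<sigma> S) v))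
                  (sorted_list_of_set (first_block \<sigma> S)))
      else 1)"
  by pat_completeness auto
termination
proof (relation "Wellfounded.measure (\<lambda>(c, a, \<sigma>, S). card S)", goal_cases)
  case (2 c a \<sigma> S v)
  then have "v \<in> S"
    using first_block_subset[of \<sigma> S] finite_subset[of "first_block \<sigma> S" S] by auto
  with 2 show ?case
    using gap_psubset[of v S "first_block \<sigma> S"] by (auto intro: psubset_card_mono)
qed auto

declare nested_cumulant.simps [simp del]

lemma nested_cumulant_cong [fundef_cong]:
  assumes "a = a'" "\<sigma> = \<sigma>'" "S = S'"
    and "\<And>T as. T \<subseteq> S' \<Longrightarrow> T \<noteq> {} \<Longrightarrow> length as = card (first_block \<sigma>' T) \<Longrightarrow> c as = c' as"
  shows "nested_cumulant c a \<sigma> S = nested_cumulant c' a' \<sigma>' S'"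
  unfolding assms(1,2,3) using assms(4)
proof (induction "card S'" arbitrary: S' rule: less_induct)
  case less
  let ?V = "first_block \<sigma>' S'"
  show ?case
  proof (cases "finite S' \<and> S' \<noteq> {}")
    case True
    then have fin: "finite ?V"
      using first_block_subset finite_subset by blast
    have eq: "nested_cumulant c a' \<sigma>' (gap S' ?V v) = nested_cumulant c' a' \<sigma>' (gap S' ?V v)"
      if "v \<in> ?V" for v
    proof (rule less.hyps)
      have "v \<in> S'" using that first_block_subset by blast
      then have ps: "gap S' ?V v \<subset> S'" by (rule gap_psubset)
      then show "card (gap S' ?V v) < card S'" using True by (auto intro: psubset_card_mono)
      show "c as = c' as" if "T \<subseteq> gap S' ?V v" "T \<noteq> {}" "length as = card (first_block \<sigma>' T)"
        for T as
        using less.prems[of T as] that ps by blast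
    qed
    have c: "c as = c' as" if "length as = card ?V" for as
      using less.prems[of S' as] True that by auto
    have m: "map (\<lambda>v. a' v * nested_cumulant c a' \<sigma>' (gap S' ?V v)) (sorted_list_of_set ?V) =
        map (\<lambda>v. a' v * nested_cumulant c' a' \<sigma>' (gap S' ?V v)) (sorted_list_of_set ?V)"
      using fin eq by (intro map_cong refl) auto
    have "c (map (\<lambda>v. a' v * nested_cumulant c a' \<sigma>' (gap S' ?V v)) (sorted_list_of_set ?V)) =
        c' (map (\<lambda>v. a' v * nested_cumulant c' a' \<sigma>' (gap S' ?V v)) (sorted_list_of_set ?V))"
      unfolding m by (rule c) simp
    then show ?thesis
      by (subst (1 2) nested_cumulant.simps) (simp only: True if_True simp_thms)
  qed (auto simp: nested_cumulant.simps)
qed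

lemma partition_on_first_block:
  assumes \<sigma>: "partition_on S \<sigma>" "\<sigma> \<noteq> {S}" and fin: "finite S" and T: "T \<subseteq> S" "T \<noteq> {}"
  shows "card (first_block \<sigma> T) < card S"
proof -
  have dis: "W' = W" if "W \<in> \<sigma>" "W' \<in> \<sigma>" "x \<in> W" "x \<in> W'" for W W' x
    using partition_onD2[OF \<sigma>(1)] that unfolding disjoint_def by blast
  have "first_block \<sigma> T \<noteq> S"
  proof
    assume eq: "first_block \<sigma> T = S"
    have min: "Min T \<in> T" using T fin finite_subset[of T S] by (intro Min_in)
    then have "Min T \<in> \<Union>\<sigma>" using T(1) partition_onD1[OF \<sigma>(1)] by blast
    then obtain W where W: "W \<in> \<sigma>" "Min T \<in> W" by blast
    have "S \<subseteq> W"
    proof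
      fix s assume "s \<in> S"
      then obtain W' where "W' \<in> \<sigma>" "Min T \<in> W'" "s \<in> W'"
        unfolding eq[symmetric] first_block_def by blast
      then show "s \<in> W" using dis[OF W(1) _ W(2)] by blast
    qed
    moreover have "W \<subseteq> S" using W(1) partition_onD1[OF \<sigma>(1)] by blast
    ultimately have WS: "W = S" by blast
    have "W' = W" if W': "W' \<in> \<sigma>" for W'
    proof -
      obtain x where x: "x \<in> W'" using W' partition_onD3[OF \<sigma>(1)] by (cases "W' = {}") auto
      then have "x \<in> W" using W' WS partition_onD1[OF \<sigma>(1)] by blast
      then show ?thesis using dis W(1) W' x by blast
    qed
    then have "\<sigma> = {S}" using W(1) WS by blast
    with \<sigma>(2) show False ..
  qed
  moreover have "first_block \<sigma> T \<subseteq> S" using first_block_subset T(1) by (rule subset_trans)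
  ultimately show ?thesis using fin by (intro psubset_card_mono psubsetI)
qed

text \<open>
  The moment-cumulant formula \<open>E (a\<^sub>1 \<cdots> a\<^sub>n) = (\<Sum>\<sigma>\<in>NC n. c\<^sub>\<sigma> (a\<^sub>1 \<otimes> \<cdots> \<otimes> a\<^sub>n))\<close>, solved for the
  term \<open>c\<^sub>n (a\<^sub>1 \<otimes> \<cdots> \<otimes> a\<^sub>n)\<close> of the one-block partition. The formula itself and uniqueness
  are proved below.
\<close>

function cumulant :: "('a::ring_1 \<Rightarrow> 'a) \<Rightarrow> 'a list \<Rightarrow> 'a" where
  "cumulant E as = E (prod_list as) -
     (\<Sum>\<sigma> \<in> NC (length as) - {{{..<length as}}}.
        nested_cumulant (cumulant E) (\<lambda>i. as ! i) \<sigma> {..<length as})"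
  by pat_completeness auto
termination
proof (relation "Wellfounded.measure (\<lambda>(E, as). length as)", goal_cases)
  case (2 E as \<sigma> T bs)
  then show ?case
    using partition_on_first_block[of "{..<length as}" \<sigma> T] by (simp add: NC_def)
qed simp

declare cumulant.simps [simp del]

lemma one_block_NC: "n > 0 \<Longrightarrow> {{..<n}} \<in> NC n"
  by (auto simp: NC_def noncrossing_def partition_on_def)

lemma finite_NC: "finite (NC n)"
  by (rule finite_subset[of _ "Pow (Pow {..<n})"]) (auto simp: NC_def partition_on_def)

lemma nested_cumulant_one_block:
  assumes "as \<noteq> []"
  shows "nested_cumulant c (\<lambda>i. as ! i) {{..<length as}} {..<length as} = c as"
proof -
  let ?S = "{..<length as}"
  have ne: "?S \<noteq> {}" using assms by auto
  then have "Min ?S \<in> ?S" by (intro Min_in) auto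
  then have V: "first_block {?S} ?S = ?S" by (auto simp: first_block_def)
  have g: "gap ?S ?S v = {}" for v by (auto simp: gap_def)
  have "nested_cumulant c (\<lambda>i. as ! i) {?S} {} = 1" by (simp add: nested_cumulant.simps)
  then have "nested_cumulant c (\<lambda>i. as ! i) {?S} ?S = c (map (\<lambda>i. as ! i) (sorted_list_of_set ?S))"
    using ne by (subst nested_cumulant.simps) (simp add: V g)
  then show ?thesis
    by (simp add: lessThan_atLeast0 map_nth)
qed

theorem moment_cumulant:
  assumes "as \<noteq> []"
  shows "E (prod_list as) =
    (\<Sum>\<sigma> \<in> NC (length as). nested_cumulant (cumulant E) (\<lambda>i. as ! i) \<sigma> {..<length as})"
proof -
  have "(\<Sum>\<sigma> \<in> NC (length as). nested_cumulant (cumulant E) (\<lambda>i. as ! i) \<sigma> {..<length as}) =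
     cumulant E as + (\<Sum>\<sigma> \<in> NC (length as) - {{{..<length as}}}.
        nested_cumulant (cumulant E) (\<lambda>i. as ! i) \<sigma> {..<length as})"
    using assms
    by (simp only: sum.remove[OF finite_NC one_block_NC] length_greater_0_conv
          nested_cumulant_one_block simp_thms)
  then show ?thesis unfolding cumulant.simps[of E as] by (simp only: diff_add_cancel)
qed

theorem cumulant_unique:
  assumes "\<And>as. as \<noteq> [] \<Longrightarrow> E (prod_list as) =
      (\<Sum>\<sigma> \<in> NC (length as). nested_cumulant c (\<lambda>i. as ! i) \<sigma> {..<length as})"
    and "as \<noteq> []"
  shows "c as = cumulant E as"
  using assms(2)
proof (induction "length as" arbitrary: as rule: less_induct)
  case less
  let ?n = "length as"
  have "E (prod_list as) = c as +
      (\<Sum>\<sigma> \<in> NC ?n - {{{..<?n}}}. nested_cumulant c (\<lambda>i. as ! i) \<sigma> {..<?n})"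
    using less.prems
    by (simp only: assms(1) sum.remove[OF finite_NC one_block_NC] length_greater_0_conv
          nested_cumulant_one_block simp_thms)
  also have "(\<Sum>\<sigma> \<in> NC ?n - {{{..<?n}}}. nested_cumulant c (\<lambda>i. as ! i) \<sigma> {..<?n}) =
      (\<Sum>\<sigma> \<in> NC ?n - {{{..<?n}}}. nested_cumulant (cumulant E) (\<lambda>i. as ! i) \<sigma> {..<?n})"
  proof (intro sum.cong refl nested_cumulant_cong)
    fix \<sigma> T and bs :: "'a list"
    assume \<sigma>: "\<sigma> \<in> NC ?n - {{{..<?n}}}" and T: "T \<subseteq> {..<?n}" "T \<noteq> {}"
      and bs: "length bs = card (first_block \<sigma> T)"
    have fin: "finite T" using T finite_subset by blast
    have "Min T \<in> T" using T fin by (intro Min_in) auto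
    moreover have "T \<subseteq> \<Union>\<sigma>" using \<sigma> T by (auto simp: NC_def partition_on_def)
    ultimately have "Min T \<in> first_block \<sigma> T" by (auto simp: first_block_def)
    then have "card (first_block \<sigma> T) \<noteq> 0"
      using fin first_block_subset[of \<sigma> T] finite_subset[of "first_block \<sigma> T" T]
      by (auto simp: card_eq_0_iff)
    then have "bs \<noteq> []" using bs by auto
    moreover have "length bs < ?n"
      using partition_on_first_block[of "{..<?n}" \<sigma> T] \<sigma> T bs by (auto simp: NC_def)
    ultimately show "c bs = cumulant E bs" by (intro less.hyps) auto
  qed
  finally show ?case unfolding cumulant.simps[of E as] by (simp only: add_diff_cancel_right')
qed


subsection \<open>Operator-valued distributions\<close>

text \<open>
  The word \<open>X\<^sub>i\<^sub>0\<^sup>\<epsilon>\<^sup>0 d\<^sub>0 \<cdots> X\<^sub>i\<^sub>n\<^sup>\<epsilon>\<^sup>n d\<^sub>n\<close> is the list of the triples \<open>(i\<^sub>j, \<epsilon>\<^sub>j, d\<^sub>j)\<close>, with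
  \<^term>\<open>True\<close> for the exponent \<open>*\<close>.
\<close>

definition diag_words :: "nat \<Rightarrow> (nat \<Rightarrow> 'a::complex_star_algebra) \<Rightarrow> ('i \<times> bool \<times> 'a) list set" where
  "diag_words d p = {w. w \<noteq> [] \<and> (\<forall>(i, \<epsilon>, e) \<in> set w. e \<in> diag d p)}"

definition diag_distribution ::
  "('a::complex_star_algebra \<Rightarrow> complex) \<Rightarrow> nat \<Rightarrow> (nat \<Rightarrow> 'a) \<Rightarrow> ('i \<Rightarrow> 'a) \<Rightarrow> ('i \<times> bool \<times> 'a) list \<Rightarrow> 'a"
where
  "diag_distribution \<phi> d p a = restrict
     (\<lambda>w. cond_exp \<phi> d p (prod_list (map (\<lambda>(i, \<epsilon>, e). (if \<epsilon> then star (a i) else a i) * e) w)))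
     (diag_words d p)"

definition diag_semicircular ::
  "('a::complex_star_algebra \<Rightarrow> complex) \<Rightarrow> nat \<Rightarrow> (nat \<Rightarrow> 'a) \<Rightarrow> 'a \<Rightarrow> bool" where
  "diag_semicircular \<phi> d p X \<longleftrightarrow>
     star X = X \<and>
     cumulant (cond_exp \<phi> d p) [X] = 0 \<and>
     (\<forall>e\<in>diag d p. cumulant (cond_exp \<phi> d p) [X * e, X] = \<phi> e *\<^sub>C 1) \<and>
     (\<forall>es. length es \<ge> 3 \<and> set es \<subseteq> diag d p
        \<longrightarrow> cumulant (cond_exp \<phi> d p) (map (\<lambda>e. X * e) es) = 0)"

text \<open>
  The distribution determined by \<^const>\<open>diag_semicircular\<close>: \<open>semicircular_cumulant \<phi> [d\<^sub>1, \<dots>, d\<^sub>k]\<close>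
  is the value \<open>c\<^sub>k (X d\<^sub>1 \<otimes> \<cdots> \<otimes> X d\<^sub>k)\<close> prescribed by that definition, and
  \<open>diag_semicircular_distribution\<close> assembles these values by the moment-cumulant formula. There
  is a single self-adjoint variable, so the exponents are irrelevant.
\<close>

definition semicircular_cumulant ::
  "('a::complex_star_algebra \<Rightarrow> complex) \<Rightarrow> 'a list \<Rightarrow> 'a" where
  "semicircular_cumulant \<phi> es = (case es of [e, f] \<Rightarrow> \<phi> e *\<^sub>C f | _ \<Rightarrow> 0)"

definition diag_semicircular_distribution ::
  "('a::complex_star_algebra \<Rightarrow> complex) \<Rightarrow> nat \<Rightarrow> (nat \<Rightarrow> 'a) \<Rightarrow> (unit \<times> bool \<times> 'a) list \<Rightarrow> 'a" where
  "diag_semicircular_distribution \<phi> d p = restrict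
     (\<lambda>w. \<Sum>\<sigma> \<in> NC (length w).
        nested_cumulant (semicircular_cumulant \<phi>) (\<lambda>i. snd (snd (w ! i))) \<sigma> {..<length w})
     (diag_words d p)"

end

theory Submission
  imports Defs
begin

text \<open>
  Since \<open>\<phi>\<close> is tracial, \<open>\<E> x = 0\<close> means \<open>\<phi> (x e) = 0\<close> for all \<open>e \<in> \<D>\<close>. An \<open>\<E>\<close>-centred element of the
  algebra generated by \<open>\<D>\<close> and the algebra \<open>A\<^sub>s\<close> of \<open>y(s)\<close> is a combination of words
  \<open>e\<^sub>0 y\<^sub>1 e\<^sub>1 \<cdots> y\<^sub>n e\<^sub>n\<close> with \<open>n \<ge> 1\<close>, \<open>\<phi>\<close>-centred \<open>y\<^sub>i \<in> A\<^sub>s\<close> and \<open>\<phi>\<close>-centred inner \<open>e\<^sub>i \<in> \<D>\<close>; in an alternating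
  product of such words and \<open>\<E>\<close>-centred elements of \<open>B\<close>, the factors of \<open>B\<close> lying between two \<open>y\<close>'s of
  the same algebra are \<open>\<phi>\<close>-centred, so that scalar freeness applies.

  For the distribution of \<open>X = y(s)\<close>, define Wick products by
  \<open>X e W(f, \<dots>) = W(e, f, \<dots>) + \<phi>(e) f W(\<dots>)\<close>. Splitting each entry into its centred and its
  scalar part exhibits \<open>W(e\<^sub>1, \<dots>, e\<^sub>n)\<close> as a combination of the words above whose letters are Chebyshev
  polynomials in \<open>X\<close>, so it is killed by \<open>\<E>\<close>. Hence the \<open>\<D>\<close>-valued moments of \<open>X\<close> obey the
  Schwinger--Dyson recurrence, which is also the recurrence of the sum over noncrossing pair
  partitions given by the position to which the first one is matched.
\<close>


subsection \<open>Chebyshev polynomials and the semicircle distribution\<close>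

text \<open>The Chebyshev polynomials of the second kind in x/2, monic and orthogonal for the
  semicircle law of radius 2. With a general ring as domain, one definition serves both real numbers
  and elements of the algebra.\<close>

fun cheb :: "'a::ring_1 \<Rightarrow> nat \<Rightarrow> 'a" where
  "cheb x 0 = 1"
| "cheb x (Suc 0) = x"
| "cheb x (Suc (Suc k)) = x * cheb x (Suc k) - cheb x k"

text \<open>The identity sin((k+3)\<theta>) + sin((k+1)\<theta>) = 2 cos \<theta> sin((k+2)\<theta>)
  is the Chebyshev recurrence multiplied by sin \<theta>.\<close>

lemma cheb_cos: "cheb (2 * cos \<theta> :: real) k * sin \<theta> = sin (real (k + 1) * \<theta>)"
proof (induction k rule: induct_nat_012)
  case 1
  show ?case using sin_double[of \<theta>] by simp
next
  case (ge2 k)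
  have "cheb (2 * cos \<theta>) (Suc (Suc k)) * sin \<theta> =
      2 * cos \<theta> * sin (real (Suc k + 1) * \<theta>) - sin (real (k + 1) * \<theta>)"
    using ge2 by (simp add: algebra_simps)
  moreover have "sin (real (Suc (Suc k) + 1) * \<theta>) + sin (real (k + 1) * \<theta>) =
      2 * cos \<theta> * sin (real (Suc k + 1) * \<theta>)"
  proof -
    have "real (Suc (Suc k) + 1) * \<theta> = real (Suc k + 1) * \<theta> + \<theta>"
      "real (k + 1) * \<theta> = real (Suc k + 1) * \<theta> - \<theta>" by (simp_all add: algebra_simps)
    then show ?thesis by (simp only: sin_add sin_diff) simp
  qed
  ultimately show ?case by linarith
qed simp

lemma continuous_on_cheb [continuous_intros]:
  "continuous_on S f \<Longrightarrow> continuous_on S (\<lambda>t. cheb (f t :: real) k)"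
  by (induction k rule: induct_nat_012) (auto intro!: continuous_intros)

text \<open>Under t = 2 cos \<theta> the integral becomes, up to a factor, that of
  cos((k+2)\<theta>) - cos(k \<theta>) over [0, pi], which vanishes.\<close>

lemma has_integral_cheb_semicircle:
  assumes "k > 0"
  shows "((\<lambda>t. cheb t k * sqrt (4 - t\<^sup>2)) has_integral 0) {- 2..2}"
proof -
  \<comment> \<open>The antiderivative in \<theta>, pulled back by \<theta> = arccos (t / 2). Both
    sines vanish at \<theta> = 0 and \<theta> = pi, so \<open>F\<close> is zero at both
    endpoints.\<close>
  define F where "F = (\<lambda>t. 2 * (sin (real (k + 2) * arccos (t / 2)) / real (k + 2)
      - sin (real k * arccos (t / 2)) / real k))"
  have cont: "continuous_on {- 2..2} F"
    unfolding F_def by (intro continuous_intros) (use assms in auto)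
  have deriv: "(F has_real_derivative cheb t k * sqrt (4 - t\<^sup>2)) (at t)" if t: "t \<in> {- 2<..<2}" for t
  proof -
    define \<theta> where "\<theta> = arccos (t / 2)"
    have bd: "- 1 < t / 2" "t / 2 < 1" using t by auto
    then have ct: "t = 2 * cos \<theta>" by (simp add: \<theta>_def)
    have \<theta>: "0 < \<theta>" "\<theta> < pi" unfolding \<theta>_def using arccos_lt_bounded[OF bd] by auto
    then have s: "sin \<theta> > 0" by (rule sin_gt_zero)
    have "4 - t\<^sup>2 = (2 * sin \<theta>)\<^sup>2" by (simp add: ct power_mult_distrib sin_squared_eq)
    then have sq: "sqrt (4 - t\<^sup>2) = 2 * sin \<theta>" using s by (simp add: real_sqrt_unique)
    have sq1: "sqrt (1 - (t / 2)\<^sup>2) = sin \<theta>"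
      using s by (intro real_sqrt_unique) (simp_all add: ct sin_squared_eq)
    have sin_deriv: "((\<lambda>t. sin (real m * arccos (t / 2)) / real m) has_real_derivative
        cos (real m * \<theta>) * (inverse (- sqrt (1 - (t / 2)\<^sup>2)) / 2)) (at t)" if "m > 0" for m
    proof -
      have "((\<lambda>t. arccos (t / 2)) has_real_derivative inverse (- sqrt (1 - (t / 2)\<^sup>2)) * (1 / 2)) (at t)"
        using bd by (intro DERIV_chain2[OF DERIV_arccos]) (auto intro!: derivative_eq_intros)
      note DERIV_cdivide[OF DERIV_chain2[OF DERIV_sin DERIV_cmult[OF this, of "real m"]], of "real m"]
      then show ?thesis using that by (simp add: \<theta>_def)
    qed
    have "(F has_real_derivative 2 * ((cos (real (k + 2) * \<theta>) - cos (real k * \<theta>)) *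
        (inverse (- sqrt (1 - (t / 2)\<^sup>2)) / 2))) (at t)"
      unfolding F_def left_diff_distrib
      by (intro DERIV_cmult DERIV_diff sin_deriv) (use assms in auto)
    moreover have "2 * ((cos (real (k + 2) * \<theta>) - cos (real k * \<theta>)) *
        (inverse (- sqrt (1 - (t / 2)\<^sup>2)) / 2)) = cheb t k * sqrt (4 - t\<^sup>2)"
    proof -
      have "real (k + 2) * \<theta> = real (k + 1) * \<theta> + \<theta>"
        "real k * \<theta> = real (k + 1) * \<theta> - \<theta>" by (simp_all add: algebra_simps)
      then have "cos (real (k + 2) * \<theta>) - cos (real k * \<theta>) = - 2 * sin (real (k + 1) * \<theta>) * sin \<theta>"
        by (simp only: cos_add cos_diff)
      also have "\<dots> = - 2 * cheb t k * sin \<theta> * sin \<theta>" by (simp only: ct cheb_cos[symmetric])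
      finally show ?thesis using s unfolding sq sq1 by (simp add: field_simps)
    qed
    ultimately show ?thesis by (simp only:)
  qed
  \<comment> \<open>The derivative is available only in the open interval, as arccos is not
    differentiable at - 1 and 1; continuity of \<open>F\<close> covers the endpoints.\<close>
  have "((\<lambda>t. cheb t k * sqrt (4 - t\<^sup>2)) has_integral (F 2 - F (- 2))) {- 2..2}"
    by (rule fundamental_theorem_of_calculus_interior)
      (use deriv cont in \<open>auto simp: has_real_derivative_iff_has_vector_derivative\<close>)
  moreover have "F 2 - F (- 2) = 0"
    by (simp add: F_def sin_npi distrib_right sin_add)
  ultimately show ?thesis by (simp only:)
qed

text \<open>Passing from the Lebesgue integral against the density to a gauge integral over [-2, 2]
  makes the fundamental theorem of calculus applicable.\<close>

lemma semicircle_integral: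
  fixes f :: "real \<Rightarrow> real"
  assumes f: "continuous_on UNIV f"
  shows "integrable (semicircle 0 2) f"
    and "integral\<^sup>L (semicircle 0 2) f = integral {- 2..2} (\<lambda>t. f t * sqrt (4 - t\<^sup>2)) / (2 * pi)"
proof -
  define w where "w = (\<lambda>t. indicator {- 2..2} t * (2 / (pi * 4)) * sqrt (4 - t\<^sup>2) :: real)"
  have sc: "semicircle 0 2 = density lborel (\<lambda>t. ennreal (w t))"
    by (simp add: semicircle_def w_def)
  have w: "w \<in> borel_measurable lborel" unfolding w_def by measurable
  have w_nonneg: "w t \<ge> 0" for t
  proof (cases "t \<in> {- 2..2}")
    case True
    then have "t\<^sup>2 \<le> 2\<^sup>2" by (intro abs_le_square_iff[THEN iffD1]) auto
    then show ?thesis by (simp add: w_def)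
  qed (simp add: w_def)
  have fm: "f \<in> borel_measurable lborel"
    using f by (simp add: borel_measurable_continuous_onI)
  have cont: "continuous_on {- 2..2} (\<lambda>t. f t * sqrt (4 - t\<^sup>2))"
    by (intro continuous_intros continuous_on_subset[OF f]) auto
  have si: "set_integrable lborel {- 2..2} (\<lambda>t. f t * sqrt (4 - t\<^sup>2))"
    by (rule borel_integrable_atLeastAtMost') (rule cont)
  have eq: "w t *\<^sub>R f t = (indicator {- 2..2} t *\<^sub>R (f t * sqrt (4 - t\<^sup>2))) / (2 * pi)" for t
    by (simp add: w_def)
  show "integrable (semicircle 0 2) f"
    unfolding sc using si
    by (subst integrable_density[OF fm w]) (simp_all add: w_nonneg eq set_integrable_def del: real_scaleR_def)
  have "integral\<^sup>L (semicircle 0 2) f = (LINT t|lborel. w t *\<^sub>R f t)"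
    unfolding sc by (rule integral_density[OF fm w]) (simp add: w_nonneg)
  also have "\<dots> = (LINT t:{- 2..2}|lborel. f t * sqrt (4 - t\<^sup>2)) / (2 * pi)"
    unfolding eq set_lebesgue_integral_def by simp
  finally show "integral\<^sup>L (semicircle 0 2) f = integral {- 2..2} (\<lambda>t. f t * sqrt (4 - t\<^sup>2)) / (2 * pi)"
    by (simp only: set_borel_integral_eq_integral[OF si])
qed

lemma cheb_commutes: "x * cheb x k = cheb x k * (x::'a::ring_1)"
proof (induction k rule: induct_nat_012)
  case (ge2 k)
  then show ?case by (simp add: right_diff_distrib left_diff_distrib mult.assoc) (simp flip: mult.assoc)
qed auto

context tracial_ncps
begin

lemma state_zero [simp]: "\<phi> 0 = 0"
  using state_scaleC[of 0 0] by simp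

lemma state_diff: "\<phi> (x - y) = \<phi> x - \<phi> y"
  using state_add[of "x - y" y] by simp

lemma state_sum: "\<phi> (sum f S) = (\<Sum>i\<in>S. \<phi> (f i))"
  by (induction S rule: infinite_finite_induct) (auto simp: state_add)

lemma state_centred [simp]: "\<phi> (x - \<phi> x *\<^sub>C 1) = 0"
  by (simp add: state_diff state_scaleC state_one)

text \<open>The splitting of a factor into its scalar and its centred part, in the form that turns
  an arbitrary separator into a letter to which freeness applies.\<close>

lemma state_centre:
  "\<phi> (x * b * z) = \<phi> b * \<phi> (x * z) + \<phi> (x * (b - \<phi> b *\<^sub>C 1) * z)"
  by (simp add: algebra_simps state_diff mult_scaleC_left mult_scaleC_right state_scaleC)

text \<open>The Chebyshev moments of \<open>X\<close> are those of the semicircle law, and these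
  vanish by orthogonality to the constant 1.\<close>

lemma state_cheb:
  assumes sc: "semicircular \<phi> X" and k: "k > 0"
  shows "\<phi> (cheb X k) = 0"
proof -
  let ?I = "\<lambda>k j. \<integral>t. cheb t k * t ^ j \<partial>semicircle 0 2"
  \<comment> \<open>The extra power closes the induction: the recurrence lowers the Chebyshev degree
    at the cost of raising j, until only plain moments remain.\<close>
  have "\<phi> (cheb X k * X ^ j) = complex_of_real (?I k j)" for j
  proof (induction k arbitrary: j rule: induct_nat_012)
    case 0
    show ?case using sc by (simp add: semicircular_def)
  next
    case 1
    have "\<phi> (X ^ Suc j) = complex_of_real (\<integral>t. t ^ Suc j \<partial>semicircle 0 2)"
      using sc unfolding semicircular_def by blast
    then show ?case by simp
  next
    case (ge2 k)
    have "\<phi> (cheb X (Suc (Suc k)) * X ^ j) = \<phi> (cheb X (Suc k) * X ^ Suc j) - \<phi> (cheb X k * X ^ j)"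
      by (simp add: left_diff_distrib state_diff) (simp add: cheb_commutes mult.assoc)
    also have "\<dots> = complex_of_real (?I (Suc k) (Suc j) - ?I k j)"
      using ge2(1)[of j] ge2(2)[of "Suc j"] by (simp only: of_real_diff)
    also have "?I (Suc k) (Suc j) - ?I k j =
        (\<integral>t. cheb t (Suc k) * t ^ Suc j - cheb t k * t ^ j \<partial>semicircle 0 2)"
      by (intro Bochner_Integration.integral_diff[symmetric] semicircle_integral(1) continuous_intros)
    also have "(\<lambda>t::real. cheb t (Suc k) * t ^ Suc j - cheb t k * t ^ j) =
        (\<lambda>t. cheb t (Suc (Suc k)) * t ^ j)"
      by (simp add: algebra_simps)
    finally show ?case .
  qed
  from this[of 0] have "\<phi> (cheb X k) = complex_of_real (\<integral>t. cheb t k \<partial>semicircle 0 2)" by simp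
  also have "(\<integral>t. cheb t k \<partial>semicircle 0 2) = 0"
    using has_integral_cheb_semicircle[OF k]
    by (simp add: semicircle_integral(2) continuous_on_cheb continuous_on_id integral_unique)
  finally show ?thesis by simp
qed

end


subsection \<open>Freeness with amalgamation\<close>

lemma span_mult:
  fixes x z :: "'a::complex_star_algebra"
  assumes "x \<in> star_alg.span S" "z \<in> star_alg.span T"
    and ST: "\<And>x z. x \<in> S \<Longrightarrow> z \<in> T \<Longrightarrow> x * z \<in> star_alg.span U"
  shows "x * z \<in> star_alg.span U"
proof -
  have 1: "x * z \<in> star_alg.span U" if "x \<in> S" "z \<in> star_alg.span T" for x z
    using that(2) that(1)
    by (induction rule: star_alg.span_induct_alt)
      (auto simp: distrib_left mult_scaleC_right intro!: star_alg.span_add star_alg.span_scale ST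
        star_alg.span_zero)
  show ?thesis using assms(1)
    by (induction rule: star_alg.span_induct_alt)
      (auto simp: distrib_right mult_scaleC_left intro!: star_alg.span_add star_alg.span_scale 1
        star_alg.span_zero assms(2))
qed

context
  fixes A :: "'a::complex_star_algebra set"
  assumes A: "unital_subalgebra A"
begin

lemma subalgebra_one: "1 \<in> A"
  and subalgebra_add: "x \<in> A \<Longrightarrow> z \<in> A \<Longrightarrow> x + z \<in> A"
  and subalgebra_mult: "x \<in> A \<Longrightarrow> z \<in> A \<Longrightarrow> x * z \<in> A"
  and subalgebra_scale: "x \<in> A \<Longrightarrow> c *\<^sub>C x \<in> A"
  using A by (auto simp: unital_subalgebra_def)

lemma subalgebra_diff: "x \<in> A \<Longrightarrow> z \<in> A \<Longrightarrow> x - z \<in> A"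
  using subalgebra_add[of x "(- 1) *\<^sub>C z"] subalgebra_scale[of z "- 1"]
  by (simp add: star_alg.scale_minus_left scaleC_one)

lemma subalgebra_cheb: "x \<in> A \<Longrightarrow> cheb x k \<in> A"
  by (induction k rule: induct_nat_012)
    (auto simp: subalgebra_one subalgebra_mult subalgebra_diff)

end

section \<open>The conditional expectation, described by duality with the diagonal\<close>

context projected_tracial_ncps
begin

abbreviation "\<D> \<equiv> diag d p"
abbreviation "\<E> \<equiv> cond_exp \<phi> d p"

lemma proj_in_diag: "i \<in> {1..d} \<Longrightarrow> p i \<in> \<D>"
  by (auto simp: diag_def intro: star_alg.span_base)

lemma unital_subalgebra_diag: "unital_subalgebra \<D>"
  unfolding unital_subalgebra_def
proof (intro conjI ballI allI)
  show "1 \<in> \<D>"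
    unfolding proj_sum[symmetric] diag_def by (intro star_alg.span_sum star_alg.span_base) auto
  show "x * z \<in> \<D>" if "x \<in> \<D>" "z \<in> \<D>" for x z
    using that unfolding diag_def
  proof (rule span_mult)
    fix x z assume "x \<in> p ` {1..d}" "z \<in> p ` {1..d}"
    then obtain i j where ij: "i \<in> {1..d}" "j \<in> {1..d}" "x = p i" "z = p j" by blast
    then show "x * z \<in> star_alg.span (p ` {1..d})"
      by (cases "i = j")
        (auto simp: proj_idem proj_orth star_alg.span_zero intro: star_alg.span_base)
  qed
qed (auto simp: diag_def intro: star_alg.span_add star_alg.span_scale)

lemmas diag_one = subalgebra_one[OF unital_subalgebra_diag]
  and diag_mult = subalgebra_mult[OF unital_subalgebra_diag]
  and diag_scale = subalgebra_scale[OF unital_subalgebra_diag]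
  and diag_diff = subalgebra_diff[OF unital_subalgebra_diag]

lemma span_diag: "star_alg.span \<D> = \<D>"
  unfolding diag_def by (rule star_alg.span_span)

lemma cond_exp_in_diag: "\<E> x \<in> \<D>"
  unfolding cond_exp_def diag_def
  by (intro star_alg.span_sum star_alg.span_scale star_alg.span_base) simp

lemma cond_exp_add: "\<E> (x + z) = \<E> x + \<E> z"
  by (simp add: cond_exp_def compressed_state_def algebra_simps state_add scaleC_add_left sum.distrib)

lemma cond_exp_scale: "\<E> (c *\<^sub>C x) = c *\<^sub>C \<E> x"
  by (simp add: cond_exp_def compressed_state_def mult_scaleC_left mult_scaleC_right state_scaleC
      star_alg.scale_sum_right scaleC_scaleC mult.left_commute)

lemma cond_exp_diff: "\<E> (x - z) = \<E> x - \<E> z"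
  using cond_exp_add[of "x - z" z] by simp

lemma state_corner: "i \<in> {1..d} \<Longrightarrow> \<phi> (p i * x * p i) = \<phi> (x * p i)"
  by (metis mult.assoc proj_idem state_trace)

lemma cond_exp_diag:
  assumes "e \<in> \<D>" shows "\<E> e = e"
  using assms unfolding diag_def
proof (induction rule: star_alg.span_induct_alt)
  case base
  show ?case using cond_exp_scale[of 0 0] by simp
next
  case (step c x z)
  then obtain j where j: "j \<in> {1..d}" "x = p j" by blast
  have "\<E> x = (\<Sum>i = 1..d. if i = j then p j else 0)"
    unfolding cond_exp_def compressed_state_def
    by (intro sum.cong refl)
      (use j in \<open>auto simp: proj_idem proj_orth rho_nonzero scaleC_one\<close>)
  then have "\<E> x = x" using j by simp
  then show ?case using step by (simp add: cond_exp_add cond_exp_scale)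
qed

text \<open>By traciality, \<phi>(x p_j) is the j-th coefficient of \<open>\<E> x\<close> times
  \<phi>(p_j), and the latter is nonzero.\<close>

lemma cond_exp_eq_0_iff: "\<E> x = 0 \<longleftrightarrow> (\<forall>e\<in>\<D>. \<phi> (x * e) = 0)"
proof
  assume 0: "\<E> x = 0"
  have "\<phi> (x * p j) = 0" if j: "j \<in> {1..d}" for j
  proof -
    have "\<E> x * p j = (\<Sum>i = 1..d. if i = j then compressed_state \<phi> p j (p j * x * p j) *\<^sub>C p j else 0)"
      unfolding cond_exp_def sum_distrib_right
      by (intro sum.cong refl) (use j in \<open>auto simp: mult_scaleC_left proj_idem proj_orth\<close>)
    then have "compressed_state \<phi> p j (p j * x * p j) *\<^sub>C p j = 0" using 0 j by simp
    then show ?thesis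
      using j by (simp add: compressed_state_def proj_nonzero rho_nonzero state_corner)
  qed
  then show "\<forall>e\<in>\<D>. \<phi> (x * e) = 0"
  proof (intro ballI)
    fix e assume "e \<in> \<D>"
    then show "\<phi> (x * e) = 0"
      unfolding diag_def
      by (induction rule: star_alg.span_induct_alt)
        (auto simp: distrib_left mult_scaleC_right state_add state_scaleC
          \<open>\<And>j. j \<in> {1..d} \<Longrightarrow> \<phi> (x * p j) = 0\<close>)
  qed
next
  assume "\<forall>e\<in>\<D>. \<phi> (x * e) = 0"
  then show "\<E> x = 0"
    by (simp add: cond_exp_def compressed_state_def state_corner proj_in_diag)
qed

text \<open>The pairing (f, e) \<mapsto> \<phi>(f e) separates the elements of \<open>\<D>\<close>,
  so identities for \<open>\<E>\<close> reduce to scalar ones.\<close>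

lemma cond_exp_eqI:
  assumes "f \<in> \<D>" "\<And>e. e \<in> \<D> \<Longrightarrow> \<phi> (x * e) = \<phi> (f * e)"
  shows "\<E> x = f"
proof -
  have "\<E> (x - f) = 0"
    unfolding cond_exp_eq_0_iff using assms(2) by (simp add: left_diff_distrib state_diff)
  then show ?thesis by (simp add: cond_exp_diff cond_exp_diag assms(1))
qed

lemma state_cond_exp: "e \<in> \<D> \<Longrightarrow> \<phi> (\<E> x * e) = \<phi> (x * e)"
proof -
  assume e: "e \<in> \<D>"
  have "\<E> (x - \<E> x) = 0" by (simp add: cond_exp_diff cond_exp_diag cond_exp_in_diag)
  then have "\<phi> ((x - \<E> x) * e) = 0" using e unfolding cond_exp_eq_0_iff by blast
  then show ?thesis by (simp add: left_diff_distrib state_diff)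
qed

end

section \<open>Words with centred letters, and the algebra generated by the diagonal and one free
  algebra\<close>

locale free_from_diag = projected_tracial_ncps \<phi> d p
  for \<phi> :: "'a::complex_star_algebra \<Rightarrow> complex" and d p +
  fixes A :: "'k option \<Rightarrow> 'a set"
  assumes subalgebra: "\<And>k. unital_subalgebra (A k)"
    and diag_subset: "\<D> \<subseteq> A None"
    and vanish: "alternating_vanish \<phi> A"
begin

text \<open>Words y_1 b_1 ... y_n b_n with separators in \<open>A None\<close>, where
  \<open>s\<close> names the algebra of the first letter. A separator must be centred only between
  two letters of the same algebra; the last one is arbitrary.\<close>

inductive alt_word :: "'k \<Rightarrow> 'a \<Rightarrow> bool" where
  alt_last: "alt_word s (y * b)" if "y \<in> A (Some s)" "\<phi> y = 0" "b \<in> A None"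
| alt_step: "alt_word s (y * b * x)"
    if "y \<in> A (Some s)" "\<phi> y = 0" "b \<in> A None" "\<phi> b = 0 \<or> s \<noteq> s'" "alt_word s' x"

text \<open>All letters come from one algebra and all separators from \<open>\<D>\<close>, so every
  inner separator has to be centred.\<close>

inductive diag_word :: "'k \<Rightarrow> 'a \<Rightarrow> bool" for s where
  diag_last: "diag_word s (y * e)" if "y \<in> A (Some s)" "\<phi> y = 0" "e \<in> \<D>"
| diag_step: "diag_word s (y * e * x)"
    if "y \<in> A (Some s)" "\<phi> y = 0" "e \<in> \<D>" "\<phi> e = 0" "diag_word s x"

text \<open>This is the algebra generated by \<open>\<D>\<close> and \<open>A (Some s)\<close>,
  given by a spanning set of normal forms; closure under products is a theorem below.\<close>

definition diag_words_span :: "'k \<Rightarrow> 'a set" where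
  "diag_words_span s = star_alg.span (\<D> \<union> {e * x | e x. e \<in> \<D> \<and> diag_word s x})"

lemma centred_in: "x \<in> A k \<Longrightarrow> x - \<phi> x *\<^sub>C 1 \<in> A k"
  by (simp add: subalgebra subalgebra_diff subalgebra_scale subalgebra_one)

lemma diag_centred_in: "e \<in> \<D> \<Longrightarrow> e - \<phi> e *\<^sub>C 1 \<in> \<D>"
  by (simp add: diag_diff diag_scale diag_one)

text \<open>Induction along the word, with a prefix of centred letters that collects what has been
  processed. The centred part of each separator joins the prefix as a letter of
  \<open>A None\<close>; its scalar part leaves two neighbouring letters of different algebras, or
  is zero.\<close>

lemma state_prefix_alt_word:
  assumes "alt_word s x" "list_all2 (\<lambda>k z. z \<in> A k \<and> \<phi> z = 0) ks zs" "distinct_adj (ks @ [Some s])"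
  shows "\<phi> (prod_list zs * x) = 0"
  using assms
proof (induction arbitrary: ks zs rule: alt_word.induct)
  case (alt_last y s b)
  have 1: "\<phi> (prod_list (zs @ [y])) = 0"
    using vanish alt_last unfolding alternating_vanish_def
    by (elim allE[of _ "ks @ [Some s]"] allE[of _ "zs @ [y]"]) (auto simp: list_all2_appendI)
  have 2: "\<phi> (prod_list (zs @ [y, b - \<phi> b *\<^sub>C 1])) = 0"
    using vanish alt_last centred_in[of b None] unfolding alternating_vanish_def
    by (elim allE[of _ "ks @ [Some s, None]"] allE[of _ "zs @ [y, b - \<phi> b *\<^sub>C 1]"])
      (auto simp: list_all2_appendI distinct_adj_append_iff)
  show ?case
    using state_centre[of "prod_list zs * y" b 1] 1 2 by (simp add: mult.assoc)
next
  case (alt_step y s b s' x)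
  have 2: "\<phi> (prod_list (zs @ [y, b - \<phi> b *\<^sub>C 1]) * x) = 0"
    using alt_step centred_in[of b None]
    by (intro alt_step.IH[of "ks @ [Some s, None]"])
      (auto simp: list_all2_appendI distinct_adj_append_iff)
  have 1: "\<phi> b * \<phi> (prod_list (zs @ [y]) * x) = 0"
  \<comment> \<open>If \<phi> b is nonzero then \<open>s\<close> and \<open>s'\<close> differ, so
    deleting \<open>b\<close> still leaves an alternating sequence of indices.\<close>
  proof (cases "\<phi> b = 0")
    case False
    then have "\<phi> (prod_list (zs @ [y]) * x) = 0"
      using alt_step
      by (intro alt_step.IH[of "ks @ [Some s]"])
        (auto simp: list_all2_appendI distinct_adj_append_iff)
    then show ?thesis by simp
  qed simp
  show ?case
    using state_centre[of "prod_list zs * y" b x] 1 2 by (simp add: mult.assoc)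
qed

lemma state_alt_word:
  assumes x: "alt_word s x" and b: "b \<in> A None"
  shows "\<phi> (b * x) = 0"
proof -
  have "\<phi> (prod_list [] * x) = 0" using x by (rule state_prefix_alt_word[where ks = "[]"]) auto
  moreover have "\<phi> (prod_list [b - \<phi> b *\<^sub>C 1] * x) = 0"
    using x by (rule state_prefix_alt_word[where ks = "[None]"]) (use b centred_in in auto)
  ultimately show ?thesis using state_centre[of 1 b x] by simp
qed

text \<open>The last separator is unconstrained and absorbs the new factor.\<close>

lemma alt_word_mult_right: "alt_word s x \<Longrightarrow> b \<in> A None \<Longrightarrow> alt_word s (x * b)"
proof (induction rule: alt_word.induct)
  case (alt_last y s c)
  then show ?case using alt_word.alt_last[of y s "c * b"]
    by (simp add: subalgebra subalgebra_mult mult.assoc)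
next
  case (alt_step y s c s' x)
  then show ?case using alt_word.alt_step[of y s c s' "x * b"]
    by (simp add: mult.assoc)
qed

lemma cond_exp_alt_word:
  assumes "alt_word s x" "b \<in> A None" shows "\<E> (b * x) = 0"
  unfolding cond_exp_eq_0_iff
  using assms diag_subset by (auto simp: mult.assoc intro!: state_alt_word alt_word_mult_right)

lemma diag_word_alt_word: "diag_word s x \<Longrightarrow> alt_word s x"
  by (induction rule: diag_word.induct) (use diag_subset in \<open>auto intro: alt_word.intros\<close>)

lemma cond_exp_span:
  assumes "x \<in> star_alg.span S" "\<And>x. x \<in> S \<Longrightarrow> \<E> x = 0"
  shows "\<E> x = 0"
  using assms(1)
  by (induction rule: star_alg.span_induct_alt)
    (auto simp: cond_exp_add cond_exp_scale assms(2) cond_exp_diag star_alg.span_zero diag_def)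

lemma diag_words_span_base:
  "e \<in> \<D> \<Longrightarrow> e \<in> diag_words_span s"
  "e \<in> \<D> \<Longrightarrow> diag_word s x \<Longrightarrow> e * x \<in> diag_words_span s"
  "diag_word s x \<Longrightarrow> x \<in> diag_words_span s"
proof -
  show *: "e \<in> \<D> \<Longrightarrow> diag_word s x \<Longrightarrow> e * x \<in> diag_words_span s" for e
    unfolding diag_words_span_def by (intro star_alg.span_base) blast
  show "diag_word s x \<Longrightarrow> x \<in> diag_words_span s"
    using *[OF diag_one] by simp
qed (simp add: diag_words_span_def star_alg.span_base)

lemma diag_words_span_lincomb:
  "x \<in> diag_words_span s \<Longrightarrow> z \<in> diag_words_span s \<Longrightarrow> c *\<^sub>C x + z \<in> diag_words_span s"
  unfolding diag_words_span_def by (intro star_alg.span_add star_alg.span_scale)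

lemma diag_mult_diag_words_span:
  assumes e: "e \<in> \<D>" and x: "x \<in> diag_words_span s" shows "e * x \<in> diag_words_span s"
  using x unfolding diag_words_span_def
  by (rule span_mult[OF star_alg.span_base[of e "{e}"], rotated])
    (use e diag_mult in \<open>auto intro!: star_alg.span_base simp flip: mult.assoc, blast\<close>)

text \<open>A leading \<open>q\<close> merges with the first letter of a word or stands before a
  centred element of \<open>\<D>\<close>; recentring \<open>q\<close> then gives normal forms again.
  An element of \<open>\<D>\<close> after \<open>q\<close> that is not centred is split
  first.\<close>

lemma mult_diag_words_span:
  assumes q: "q \<in> A (Some s)" and x: "x \<in> diag_words_span s" shows "q * x \<in> diag_words_span s"
proof -
  have centre: "q * z = \<phi> q *\<^sub>C z + (q - \<phi> q *\<^sub>C 1) * z" for q z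
    by (simp add: left_diff_distrib mult_scaleC_left)
  have 1: "q * e \<in> diag_words_span s" if "q \<in> A (Some s)" "e \<in> \<D>" for q e
    unfolding centre[of q e] using that
    by (intro diag_words_span_lincomb diag_words_span_base diag_last centred_in) auto
  have 2: "q * e * x \<in> diag_words_span s"
    if q: "q \<in> A (Some s)" and e: "e \<in> \<D>" "\<phi> e = 0" and x: "diag_word s x" for q e x
    unfolding mult.assoc centre[of q "e * x"] using that
    by (intro diag_words_span_lincomb diag_words_span_base(2,3))
      (simp_all add: diag_step centred_in flip: mult.assoc)
  have 3: "q * x \<in> diag_words_span s" if q: "q \<in> A (Some s)" and x: "diag_word s x" for q x
    using x
  proof cases
    case (diag_last y e)
    then show ?thesis using q 1[of "q * y" e]
      by (simp add: subalgebra subalgebra_mult mult.assoc)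
  next
    case (diag_step y e z)
    then show ?thesis using q 2[of "q * y" e z]
      by (simp add: subalgebra subalgebra_mult mult.assoc)
  qed
  have 4: "q * (e * x) \<in> diag_words_span s"
    if q: "q \<in> A (Some s)" and e: "e \<in> \<D>" and x: "diag_word s x" for q e x
  proof -
    have "q * (e * x) = \<phi> e *\<^sub>C (q * x) + q * (e - \<phi> e *\<^sub>C 1) * x"
      by (simp add: algebra_simps mult_scaleC_left mult_scaleC_right)
    then show ?thesis
      using diag_words_span_lincomb[OF 3[OF q x] 2[OF q diag_centred_in[OF e] _ x]] by simp
  qed
  show ?thesis
    using x unfolding diag_words_span_def
    by (rule span_mult[OF star_alg.span_base[of q "{q}"], rotated])
      (use q 1 4 in \<open>auto simp: diag_words_span_def\<close>)
qed

lemma diag_word_mult_diag_words_span: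
  "diag_word s r \<Longrightarrow> x \<in> diag_words_span s \<Longrightarrow> r * x \<in> diag_words_span s"
  by (induction rule: diag_word.induct)
    (simp_all add: mult.assoc mult_diag_words_span diag_mult_diag_words_span)

lemma unital_subalgebra_diag_words_span: "unital_subalgebra (diag_words_span s)"
  unfolding unital_subalgebra_def
proof (intro conjI ballI allI)
  show "x * z \<in> diag_words_span s" if x: "x \<in> diag_words_span s" and z: "z \<in> diag_words_span s" for x z
    using x[unfolded diag_words_span_def] z[unfolded diag_words_span_def]
    unfolding diag_words_span_def
  proof (rule span_mult)
    fix x z
    assume "x \<in> \<D> \<union> {e * x |e x. e \<in> \<D> \<and> diag_word s x}"
      and "z \<in> \<D> \<union> {e * x |e x. e \<in> \<D> \<and> diag_word s x}"
    then have "x * z \<in> diag_words_span s"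
      by (auto simp: mult.assoc diag_word_mult_diag_words_span diag_mult_diag_words_span
          diag_words_span_base)
    then show "x * z \<in> star_alg.span (\<D> \<union> {e * x |e x. e \<in> \<D> \<and> diag_word s x})"
      by (simp add: diag_words_span_def)
  qed
qed (auto simp: diag_words_span_def diag_one
    intro: star_alg.span_add star_alg.span_scale star_alg.span_base)

lemma subset_diag_words_span: "A (Some s) \<subseteq> diag_words_span s"
  using mult_diag_words_span[OF _ diag_words_span_base(1)[OF diag_one]] by fastforce

text \<open>\<open>\<E>\<close> kills all words and fixes \<open>\<D>\<close>, so the
  \<open>\<D>\<close>-component of an \<E>-centred element is its expectation, namely zero.\<close>

lemma centred_diag_words_span:
  assumes x: "x \<in> diag_words_span s" and 0: "\<E> x = 0"
  shows "x \<in> star_alg.span {e * x | e x. e \<in> \<D> \<and> diag_word s x}"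
proof -
  let ?W = "{e * x | e x. e \<in> \<D> \<and> diag_word s x}"
  obtain e w where ew: "x = e + w" "e \<in> star_alg.span \<D>" "w \<in> star_alg.span ?W"
    using x unfolding diag_words_span_def star_alg.span_Un by blast
  have e: "e \<in> \<D>" using ew(2) by (simp only: span_diag)
  have "\<E> w = 0"
    using ew(3) by (rule cond_exp_span) (use diag_subset in \<open>auto intro!: cond_exp_alt_word diag_word_alt_word\<close>)
  then have "e = 0" using 0 e ew(1) by (simp add: cond_exp_add cond_exp_diag)
  then show ?thesis using ew by simp
qed

section \<open>Alternating products over the amalgamated algebras\<close>

fun amalgam :: "'k option \<Rightarrow> 'a set" where
  "amalgam None = A None"
| "amalgam (Some s) = diag_words_span s"

text \<open>The shapes of alternating products by the index of their first factor. For
  \<open>None\<close> the head stays \<E>-centred rather than just \<phi>-centred, because an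
  element of \<open>\<D>\<close> may still be multiplied to it from the left.\<close>

fun starting :: "'k option \<Rightarrow> 'a set" where
  "starting None = {b. b \<in> A None \<and> \<E> b = 0} \<union> {b * x | b s x. b \<in> A None \<and> \<E> b = 0 \<and> alt_word s x}"
| "starting (Some s) = {e * x | e x. e \<in> \<D> \<and> alt_word s x}"

lemma cond_exp_0_diag_mult:
  assumes "\<E> b = 0" "e \<in> \<D>"
  shows "\<E> (b * e) = 0" "\<E> (e * b) = 0" "\<phi> (e * b) = 0"
proof -
  have *: "\<phi> (b * f) = 0" if "f \<in> \<D>" for f using assms(1) that by (simp add: cond_exp_eq_0_iff)
  show "\<E> (b * e) = 0" unfolding cond_exp_eq_0_iff
    using * assms(2) by (simp add: mult.assoc diag_mult)
  show "\<E> (e * b) = 0" unfolding cond_exp_eq_0_iff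
    using * assms(2) by (simp add: mult.assoc state_trace[of e] diag_mult)
  show "\<phi> (e * b) = 0" using * assms(2) by (simp add: state_trace[of e])
qed

lemma cond_exp_starting: "x \<in> starting k \<Longrightarrow> \<E> x = 0"
  using diag_subset by (cases k) (auto intro!: cond_exp_alt_word)

text \<open>The free last separator e of the word merges with the head of \<open>z\<close>. If the
  head is an \<E>-centred b followed by letters, then \<phi>(e b) = 0; if it lies in
  \<open>\<D>\<close>, the letters on both sides come from different algebras. Either way the new
  separator is admissible.\<close>

lemma diag_word_mult_starting:
  assumes "diag_word s r" "z \<in> starting k" "k \<noteq> Some s"
  shows "alt_word s (r * z)"
  using assms(1)
proof (induction rule: diag_word.induct)
  case (diag_last y e)
  have e: "e \<in> A None" using diag_last diag_subset by blast
  note sm = subalgebra_mult[OF subalgebra]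
  show ?case
  proof (cases k)
    case None
    with assms(2) consider "z \<in> A None" "\<E> z = 0"
      | b s' x where "z = b * x" "b \<in> A None" "\<E> b = 0" "alt_word s' x" by auto
    then show ?thesis
    proof cases
      case 1
      then show ?thesis using alt_last[of y s "e * z"] diag_last sm[OF e] by (simp add: mult.assoc)
    next
      case 2
      then show ?thesis
        using alt_step[of y s "e * b" s' x] diag_last sm[OF e] cond_exp_0_diag_mult(3)
        by (simp add: mult.assoc)
    qed
  next
    case (Some s')
    then obtain f x where "z = f * x" "f \<in> \<D>" "alt_word s' x" using assms(2) by auto
    then show ?thesis
      using alt_step[of y s "e * f" s' x] diag_last sm[OF e] diag_subset assms(3) Some
      by (auto simp: mult.assoc)
  qed
next
  case (diag_step y e x)
  then show ?case using alt_step[of y s e s "x * z"] diag_subset by (auto simp: mult.assoc)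
qed

lemma prod_starting:
  assumes "list_all2 (\<lambda>k x. x \<in> amalgam k \<and> \<E> x = 0) ks xs" "distinct_adj ks" "ks \<noteq> []"
  shows "prod_list xs \<in> star_alg.span (starting (hd ks))"
  using assms
proof (induction rule: list_all2_induct)
  case (Cons k ks x xs)
  show ?case
  proof (cases k)
    case None
    then have x: "x \<in> A None" "\<E> x = 0" using Cons by auto
    show ?thesis
    proof (cases ks)
      case Nil
      then show ?thesis using x None Cons.hyps by (auto intro!: star_alg.span_base)
    next
      case (Cons k' ks')
      with None Cons.prems obtain s where k': "k' = Some s" by (cases k') auto
      have IH: "prod_list xs \<in> star_alg.span (starting (Some s))"
        using Cons.IH Cons.prems Cons k' by simp
      have "x * prod_list xs \<in> star_alg.span (starting None)"
        using star_alg.span_base[of x "{x}"] IH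
      proof (rule span_mult)
        \<comment> \<open>The diagonal factor heading \<open>z\<close> is absorbed by
          \<open>x\<close>, which stays \<E>-centred on right multiplication by
          \<open>\<D>\<close>.\<close>
        fix x' z assume "x' \<in> {x}" "z \<in> starting (Some s)"
        then obtain e r where "x' = x" "z = e * r" "e \<in> \<D>" "alt_word s r" by auto
        then have "x' * z \<in> starting None"
          using x diag_subset cond_exp_0_diag_mult(1)[of x e] subalgebra_mult[OF subalgebra, of x None e]
          by (auto simp flip: mult.assoc)
        then show "x' * z \<in> star_alg.span (starting None)" by (rule star_alg.span_base)
      qed simp
      then show ?thesis using None by simp
    qed
  next
    case (Some s)
    then have x: "x \<in> star_alg.span {e * x | e x. e \<in> \<D> \<and> diag_word s x}"
      using Cons centred_diag_words_span by auto
    show ?thesis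
    proof (cases ks)
      case Nil
      have "x \<in> star_alg.span (starting (Some s))"
        using x diag_word_alt_word by (elim star_alg.span_mono[THEN subsetD, rotated]) auto
      then show ?thesis using Some Cons.hyps Nil by auto
    next
      case (Cons k' ks')
      then have k': "k' \<noteq> Some s" using Some Cons.prems by auto
      have IH: "prod_list xs \<in> star_alg.span (starting k')"
        using Cons.IH Cons.prems Cons k' by simp
      have "x * prod_list xs \<in> star_alg.span (starting (Some s))"
        using x IH
      proof (rule span_mult)
        fix x z assume "x \<in> {e * x | e x. e \<in> \<D> \<and> diag_word s x}" "z \<in> starting k'"
        then have "x * z \<in> starting (Some s)"
          using diag_word_mult_starting[OF _ _ k'] by (simp add: mult.assoc) (metis mult.assoc)
        then show "x * z \<in> star_alg.span (starting (Some s))" by (rule star_alg.span_base)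
      qed
      then show ?thesis using Some by simp
    qed
  qed
qed simp

lemma alternating_vanish_amalgam: "alternating_vanish \<E> amalgam"
  unfolding alternating_vanish_def
proof (intro allI impI, elim conjE)
  fix ks xs
  assume "ks \<noteq> []" "distinct_adj ks" "list_all2 (\<lambda>k x. x \<in> amalgam k \<and> \<E> x = 0) ks xs"
  then have "prod_list xs \<in> star_alg.span (starting (hd ks))" by (intro prod_starting)
  then show "\<E> (prod_list xs) = 0" by (rule cond_exp_span) (rule cond_exp_starting)
qed

lemma amalgamated_free:
  assumes "\<And>k. \<Gamma> k \<subseteq> A k"
  shows "amalgamated_free_family \<phi> d p \<Gamma>"
  unfolding amalgamated_free_family_def
proof (intro exI[of _ amalgam] conjI allI alternating_vanish_amalgam)
  fix k
  show "unital_subalgebra (amalgam k)"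
    by (cases k) (simp_all add: subalgebra unital_subalgebra_diag_words_span)
  show "\<D> \<subseteq> amalgam k" using diag_subset by (cases k) (auto simp: diag_words_span_base)
  show "\<Gamma> k \<subseteq> amalgam k" using assms[of k] subset_diag_words_span by (cases k) auto
qed

end


subsection \<open>Sums over noncrossing partitions\<close>

text \<open>Index sets other than initial segments are needed because the recursion descends to the
  gaps between block elements.\<close>

definition NC_on :: "nat set \<Rightarrow> nat set set set" where
  "NC_on S = {\<sigma>. partition_on S \<sigma> \<and> noncrossing \<sigma>}"

lemma NC_eq_NC_on: "NC n = NC_on {..<n}"
  by (simp add: NC_def NC_on_def)

lemma finite_NC_on: "finite S \<Longrightarrow> finite (NC_on S)"
  by (rule finite_subset[of _ "Pow (Pow S)"]) (auto simp: NC_on_def partition_on_def)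

lemma NC_on_empty: "NC_on {} = {{}}"
  by (auto simp: NC_on_def noncrossing_def partition_on_def)

lemma nested_cumulant_empty [simp]: "nested_cumulant c a \<sigma> {} = 1"
  by (simp add: nested_cumulant.simps)

text \<open>The recursion sees only the relation of lying in a common block, restricted to
  \<open>S\<close>. Hence a partition may be replaced by its part inside a gap.\<close>

lemma nested_cumulant_cong_on:
  assumes "\<And>s t. s \<in> S \<Longrightarrow> t \<in> S \<Longrightarrow> (\<exists>W\<in>\<sigma>. s \<in> W \<and> t \<in> W) \<longleftrightarrow> (\<exists>W\<in>\<sigma>'. s \<in> W \<and> t \<in> W)"
    and "\<And>s. s \<in> S \<Longrightarrow> a s = a' s"
  shows "nested_cumulant c a \<sigma> S = nested_cumulant c a' \<sigma>' S"
  using assms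
proof (induction "card S" arbitrary: S rule: less_induct)
  case less
  show ?case
  proof (cases "finite S \<and> S \<noteq> {}")
    case True
    then have V: "first_block \<sigma> S = first_block \<sigma>' S"
      using less.prems(1)[of "Min S"] by (auto simp: first_block_def)
    have fin: "finite (first_block \<sigma>' S)"
      using True first_block_subset finite_subset by blast
    have "nested_cumulant c a \<sigma> (gap S (first_block \<sigma>' S) v) =
        nested_cumulant c a' \<sigma>' (gap S (first_block \<sigma>' S) v)" if "v \<in> first_block \<sigma>' S" for v
    proof -
      have ps: "gap S (first_block \<sigma>' S) v \<subset> S"
        using that first_block_subset by (intro gap_psubset) blast
      show ?thesis
      proof (rule less.hyps)
        show "card (gap S (first_block \<sigma>' S) v) < card S"
          using ps True by (simp add: psubset_card_mono)
        show "(\<exists>W\<in>\<sigma>. s \<in> W \<and> t \<in> W) \<longleftrightarrow> (\<exists>W\<in>\<sigma>'. s \<in> W \<and> t \<in> W)"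
          if "s \<in> gap S (first_block \<sigma>' S) v" "t \<in> gap S (first_block \<sigma>' S) v" for s t
          by (rule less.prems) (use that ps in auto)
      qed (use ps less.prems(2) in auto)
    qed
    then have "map (\<lambda>v. a v * nested_cumulant c a \<sigma> (gap S (first_block \<sigma>' S) v))
          (sorted_list_of_set (first_block \<sigma>' S)) =
        map (\<lambda>v. a' v * nested_cumulant c a' \<sigma>' (gap S (first_block \<sigma>' S) v))
          (sorted_list_of_set (first_block \<sigma>' S))"
      using fin first_block_subset[of \<sigma>' S] less.prems(2) by (auto simp: subset_iff)
    then show ?thesis
      using True by (subst (1 2) nested_cumulant.simps) (simp only: V)
  qed (auto simp: nested_cumulant.simps)
qed

section \<open>Splitting a noncrossing partition at the block of its first position\<close>

lemma first_block_eq: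
  assumes \<sigma>: "partition_on S \<sigma>" and "V \<in> \<sigma>" "Min S \<in> V"
  shows "first_block \<sigma> S = V"
proof -
  have "W = V" if "W \<in> \<sigma>" "Min S \<in> W" for W
    using disjointD[OF partition_onD2[OF \<sigma>] that(1) assms(2)] assms(3) that(2) by blast
  moreover have "V \<subseteq> S" using partition_onD1[OF \<sigma>] assms(2) by blast
  ultimately show ?thesis using assms(2,3) unfolding first_block_def by blast
qed

lemma semicircular_cumulant_length: "length es \<noteq> 2 \<Longrightarrow> semicircular_cumulant \<phi> es = 0"
  by (auto simp: semicircular_cumulant_def split: list.split)

text \<open>A block with points on both sides of \<open>j\<close> would cross {l, j}, since all its
  points come after \<open>l\<close>.\<close>

lemma noncrossing_first_pair:
  assumes \<sigma>: "\<sigma> \<in> NC_on {l..<r}" and V: "{l, j} \<in> \<sigma>" and j: "j \<in> {l<..<r}"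
    and W: "W \<in> \<sigma>" "W \<noteq> {l, j}"
  shows "W \<subseteq> {l<..<j} \<or> W \<subseteq> {j<..<r}"
proof -
  have part: "partition_on {l..<r} \<sigma>" and nc: "noncrossing \<sigma>" using \<sigma> by (auto simp: NC_on_def)
  have "W \<inter> {l, j} = {}" using disjointD[OF partition_onD2[OF part] W(1) V W(2)] .
  moreover have "W \<subseteq> {l..<r}" using partition_onD1[OF part] W by blast
  ultimately have sub: "l < x \<and> x < r \<and> x \<noteq> j" if "x \<in> W" for x using that by (force simp: le_less)
  have "\<not> (x < j \<and> j < z)" if "x \<in> W" "z \<in> W" for x z
  proof
    assume "x < j \<and> j < z"
    then have "\<exists>i\<in>{l, j}. \<exists>j'\<in>W. \<exists>k\<in>{l, j}. \<exists>l'\<in>W. i < j' \<and> j' < k \<and> k < l'"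
      using that sub[of x] by blast
    then show False using nc V W unfolding noncrossing_def by metis
  qed
  then show ?thesis using sub by (meson greaterThanLessThan_iff linorder_neqE_nat subsetI)
qed

text \<open>The Catalan decomposition. The inverse map keeps the blocks contained in each of the two
  gaps.\<close>

lemma NC_on_first_pair:
  assumes j: "j \<in> {l<..<r}"
  shows "bij_betw (\<lambda>(\<sigma>1, \<sigma>2). insert {l, j} (\<sigma>1 \<union> \<sigma>2))
    (NC_on {l<..<j} \<times> NC_on {j<..<r}) {\<sigma> \<in> NC_on {l..<r}. {l, j} \<in> \<sigma>}"
proof (rule bij_betw_byWitness[where f' = "\<lambda>\<sigma>. (\<sigma> \<inter> Pow {l<..<j}, \<sigma> \<inter> Pow {j<..<r})"])
  have "insert {l, j} (\<sigma>1 \<union> \<sigma>2) \<inter> Pow {l<..<j} = \<sigma>1 \<and> insert {l, j} (\<sigma>1 \<union> \<sigma>2) \<inter> Pow {j<..<r} = \<sigma>2"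
    if "\<sigma>1 \<in> NC_on {l<..<j}" "\<sigma>2 \<in> NC_on {j<..<r}" for \<sigma>1 \<sigma>2
  proof -
    have 1: "\<sigma>1 \<subseteq> Pow {l<..<j}" "{} \<notin> \<sigma>1" and 2: "\<sigma>2 \<subseteq> Pow {j<..<r}" "{} \<notin> \<sigma>2"
      using that by (auto simp: NC_on_def partition_on_def)
    \<comment> \<open>A block contained in both gaps would be empty, so each half is recovered
      exactly from the union.\<close>
    have dis: "U = {}" if "U \<subseteq> {l<..<j}" "U \<subseteq> {j<..<r}" for U using that by fastforce
    have "\<sigma>1 \<inter> Pow {j<..<r} = {}"
    proof (rule equals0I)
      fix U assume "U \<in> \<sigma>1 \<inter> Pow {j<..<r}"
      then show False using 1 dis[of U] by auto
    qed
    moreover have "\<sigma>2 \<inter> Pow {l<..<j} = {}"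
    proof (rule equals0I)
      fix U assume "U \<in> \<sigma>2 \<inter> Pow {l<..<j}"
      then show False using 2 dis[of U] by auto
    qed
    moreover have "\<sigma>1 \<inter> Pow {l<..<j} = \<sigma>1" "\<sigma>2 \<inter> Pow {j<..<r} = \<sigma>2" using 1(1) 2(1) by blast+
    moreover have "\<not> {l, j} \<subseteq> {l<..<j}" "\<not> {l, j} \<subseteq> {j<..<r}" by auto
    ultimately show ?thesis by (simp add: Int_Un_distrib2 Int_insert_left)
  qed
  then show "\<forall>\<sigma>\<in>NC_on {l<..<j} \<times> NC_on {j<..<r}.
      (case case \<sigma> of (\<sigma>1, \<sigma>2) \<Rightarrow> insert {l, j} (\<sigma>1 \<union> \<sigma>2) of
        \<sigma> \<Rightarrow> (\<sigma> \<inter> Pow {l<..<j}, \<sigma> \<inter> Pow {j<..<r})) = \<sigma>"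
    by auto
  show "\<forall>\<sigma>\<in>{\<sigma> \<in> NC_on {l..<r}. {l, j} \<in> \<sigma>}.
      (case (\<sigma> \<inter> Pow {l<..<j}, \<sigma> \<inter> Pow {j<..<r}) of (\<sigma>1, \<sigma>2) \<Rightarrow> insert {l, j} (\<sigma>1 \<union> \<sigma>2)) = \<sigma>"
  proof
    fix \<sigma> assume \<sigma>: "\<sigma> \<in> {\<sigma> \<in> NC_on {l..<r}. {l, j} \<in> \<sigma>}"
    then have "W = {l, j} \<or> W \<in> Pow {l<..<j} \<or> W \<in> Pow {j<..<r}" if "W \<in> \<sigma>" for W
      using noncrossing_first_pair[OF _ _ j that] by auto
    then have "insert {l, j} (\<sigma> \<inter> Pow {l<..<j} \<union> \<sigma> \<inter> Pow {j<..<r}) = \<sigma>" using \<sigma> by blast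
    then show "(case (\<sigma> \<inter> Pow {l<..<j}, \<sigma> \<inter> Pow {j<..<r}) of
      (\<sigma>1, \<sigma>2) \<Rightarrow> insert {l, j} (\<sigma>1 \<union> \<sigma>2)) = \<sigma>" by simp
  qed
  show "(\<lambda>(\<sigma>1, \<sigma>2). insert {l, j} (\<sigma>1 \<union> \<sigma>2)) ` (NC_on {l<..<j} \<times> NC_on {j<..<r})
      \<subseteq> {\<sigma> \<in> NC_on {l..<r}. {l, j} \<in> \<sigma>}"
  proof clarify
    fix \<sigma>1 \<sigma>2 assume \<sigma>: "\<sigma>1 \<in> NC_on {l<..<j}" "\<sigma>2 \<in> NC_on {j<..<r}"
    then have p1: "partition_on {l<..<j} \<sigma>1" and p2: "partition_on {j<..<r} \<sigma>2"
      and n1: "noncrossing \<sigma>1" and n2: "noncrossing \<sigma>2" by (auto simp: NC_on_def)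
    have s1: "W \<subseteq> {l<..<j}" if "W \<in> \<sigma>1" for W using partition_onD1[OF p1] that by blast
    have s2: "W \<subseteq> {j<..<r}" if "W \<in> \<sigma>2" for W using partition_onD1[OF p2] that by blast
    have Un: "\<Union>\<sigma>1 = {l<..<j}" "\<Union>\<sigma>2 = {j<..<r}"
      using p1 p2 by (simp_all add: partition_on_def)
    have "partition_on {l..<r} (insert {l, j} (\<sigma>1 \<union> \<sigma>2))"
    proof (rule partition_onI)
      have "{l..<r} = {l, j} \<union> {l<..<j} \<union> {j<..<r}" using j by auto
      then show "\<Union>(insert {l, j} (\<sigma>1 \<union> \<sigma>2)) = {l..<r}" by (simp add: Un Un_assoc)
      show "{} \<notin> insert {l, j} (\<sigma>1 \<union> \<sigma>2)" using p1 p2 by (simp add: partition_on_def)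
      fix V W assume VW: "V \<in> insert {l, j} (\<sigma>1 \<union> \<sigma>2)" "W \<in> insert {l, j} (\<sigma>1 \<union> \<sigma>2)" "V \<noteq> W"
      have "disjnt {l, j} U" if "U \<in> \<sigma>1 \<union> \<sigma>2" for U
      proof -
        have "U \<subseteq> {l<..<j} \<or> U \<subseteq> {j<..<r}" using that s1 s2 by blast
        then have "l \<notin> U \<and> j \<notin> U" using j by auto
        then show ?thesis by (simp add: disjnt_def)
      qed
      moreover have "disjnt U U'" "disjnt U' U" if "U \<in> \<sigma>1" "U' \<in> \<sigma>2" for U U'
      proof -
        have "x < j \<and> j < x" if "x \<in> U" "x \<in> U'" for x
          using s1[OF \<open>U \<in> \<sigma>1\<close>] s2[OF \<open>U' \<in> \<sigma>2\<close>] that by (meson greaterThanLessThan_iff subsetD)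
        then show "disjnt U U'" "disjnt U' U" unfolding disjnt_iff by (meson less_asym)+
      qed
      moreover have "disjnt U U'" if "U \<in> \<sigma>1" "U' \<in> \<sigma>1" "U \<noteq> U'" for U U'
        using that partition_onD2[OF p1] by (simp add: disjoint_def disjnt_def)
      moreover have "disjnt U U'" if "U \<in> \<sigma>2" "U' \<in> \<sigma>2" "U \<noteq> U'" for U U'
        using that partition_onD2[OF p2] by (simp add: disjoint_def disjnt_def)
      ultimately show "disjnt V W" using VW unfolding insert_iff Un_iff
        by (elim disjE) (simp_all add: disjnt_sym[of _ "{l, j}"])
    qed
    moreover have "noncrossing (insert {l, j} (\<sigma>1 \<union> \<sigma>2))"
      unfolding noncrossing_def
    proof (intro ballI impI notI)
      fix V W
      assume VW: "V \<in> insert {l, j} (\<sigma>1 \<union> \<sigma>2)" "W \<in> insert {l, j} (\<sigma>1 \<union> \<sigma>2)" "V \<noteq> W"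
        and "\<exists>a\<in>V. \<exists>b\<in>W. \<exists>c\<in>V. \<exists>e\<in>W. a < b \<and> b < c \<and> c < e"
      then obtain a b c e where q: "a \<in> V" "b \<in> W" "c \<in> V" "e \<in> W" "a < b" "b < c" "c < e" by blast
      have loc: "U = {l, j} \<or> U \<in> \<sigma>1 \<and> U \<subseteq> {l<..<j} \<or> U \<in> \<sigma>2 \<and> U \<subseteq> {j<..<r}"
        if "U \<in> insert {l, j} (\<sigma>1 \<union> \<sigma>2)" for U using that s1 s2 by auto
      \<comment> \<open>Distinct blocks in the same gap do not cross by assumption; in the mixed
        cases a crossing contradicts the order of \<open>l\<close>, the first gap, \<open>j\<close>
        and the second gap.\<close>
      consider "V \<in> \<sigma>1" "W \<in> \<sigma>1" | "V \<in> \<sigma>2" "W \<in> \<sigma>2" | "V = {l, j}" "W = {l, j}"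
        | "V = {l, j}" "W \<subseteq> {l<..<j} \<or> W \<subseteq> {j<..<r}" | "W = {l, j}" "V \<subseteq> {l<..<j} \<or> V \<subseteq> {j<..<r}"
        | "V \<subseteq> {l<..<j}" "W \<subseteq> {j<..<r}" | "W \<subseteq> {l<..<j}" "V \<subseteq> {j<..<r}"
        using loc[OF VW(1)] loc[OF VW(2)] by argo
      then show False
      proof cases
        case 1 then show False using n1 VW(3) q unfolding noncrossing_def by blast
      next
        case 2 then show False using n2 VW(3) q unfolding noncrossing_def by blast
      next
        case 3 then show False using VW(3) by simp
      next
        case 4 then show False using q j by fastforce
      next
        case 5 then show False using q j by fastforce
      next
        case 6 then show False using q by fastforce
      next
        case 7 then show False using q by fastforce
      qed
    qed
    ultimately show "insert {l, j} (\<sigma>1 \<union> \<sigma>2) \<in> NC_on {l..<r} \<and> {l, j} \<in> insert {l, j} (\<sigma>1 \<union> \<sigma>2)"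
      by (simp add: NC_on_def)
  qed
  show "(\<lambda>\<sigma>. (\<sigma> \<inter> Pow {l<..<j}, \<sigma> \<inter> Pow {j<..<r})) ` {\<sigma> \<in> NC_on {l..<r}. {l, j} \<in> \<sigma>}
      \<subseteq> NC_on {l<..<j} \<times> NC_on {j<..<r}"
  proof clarify
    fix \<sigma> assume \<sigma>: "\<sigma> \<in> NC_on {l..<r}" "{l, j} \<in> \<sigma>"
    have part: "partition_on {l..<r} \<sigma>" and nc: "noncrossing \<sigma>" using \<sigma> by (auto simp: NC_on_def)
    have cov: "\<exists>W\<in>\<sigma>. x \<in> W \<and> (W \<subseteq> {l<..<j} \<or> W \<subseteq> {j<..<r})" if "x \<in> {l<..<r}" "x \<noteq> j" for x
    proof -
      have "x \<in> \<Union>\<sigma>" using that partition_onD1[OF part] by auto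
      then obtain W where "W \<in> \<sigma>" "x \<in> W" by blast
      moreover have "W \<noteq> {l, j}" using that \<open>x \<in> W\<close> by auto
      ultimately show ?thesis using noncrossing_first_pair[OF \<sigma> j] by blast
    qed
    have restrict: "partition_on G (\<sigma> \<inter> Pow G)"
      if "\<And>x. x \<in> G \<Longrightarrow> \<exists>W\<in>\<sigma>. x \<in> W \<and> W \<subseteq> G" for G
    proof (rule partition_onI)
      show "\<Union>(\<sigma> \<inter> Pow G) = G" using that by (intro equalityI subsetI) blast+
      show "{} \<notin> \<sigma> \<inter> Pow G" using partition_onD3[OF part] by blast
      show "disjnt V W" if "V \<in> \<sigma> \<inter> Pow G" "W \<in> \<sigma> \<inter> Pow G" "V \<noteq> W" for V W
        using disjointD[OF partition_onD2[OF part], of V W] that by (simp add: disjnt_def)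
    qed
    have 1: "partition_on {l<..<j} (\<sigma> \<inter> Pow {l<..<j})"
    proof (rule restrict)
      fix x assume x: "x \<in> {l<..<j}"
      then obtain W where W: "W \<in> \<sigma>" "x \<in> W" "W \<subseteq> {l<..<j} \<or> W \<subseteq> {j<..<r}"
        using cov[of x] j by (metis greaterThanLessThan_iff less_irrefl less_trans)
      moreover have "\<not> W \<subseteq> {j<..<r}" using x W(2) by (meson greaterThanLessThan_iff less_asym subsetD)
      ultimately show "\<exists>W\<in>\<sigma>. x \<in> W \<and> W \<subseteq> {l<..<j}" by blast
    qed
    have 2: "partition_on {j<..<r} (\<sigma> \<inter> Pow {j<..<r})"
    proof (rule restrict)
      fix x assume x: "x \<in> {j<..<r}"
      then obtain W where W: "W \<in> \<sigma>" "x \<in> W" "W \<subseteq> {l<..<j} \<or> W \<subseteq> {j<..<r}"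
        using cov[of x] j by (metis greaterThanLessThan_iff less_irrefl less_trans)
      moreover have "\<not> W \<subseteq> {l<..<j}" using x W(2) by (meson greaterThanLessThan_iff less_asym subsetD)
      ultimately show "\<exists>W\<in>\<sigma>. x \<in> W \<and> W \<subseteq> {j<..<r}" by blast
    qed
    have "noncrossing (\<sigma> \<inter> U)" for U using nc unfolding noncrossing_def by blast
    then show "\<sigma> \<inter> Pow {l<..<j} \<in> NC_on {l<..<j} \<and> \<sigma> \<inter> Pow {j<..<r} \<in> NC_on {j<..<r}"
      using 1 2 by (auto simp: NC_on_def)
  qed
qed

section \<open>The recurrence for semicircular moment sums\<close>

context tracial_ncps
begin

text \<open>As \<open>semicircular_cumulant\<close> vanishes on lists of length other than two, this
  is in effect the sum over noncrossing pair partitions.\<close>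

definition nc_sum :: "(nat \<Rightarrow> 'a) \<Rightarrow> nat set \<Rightarrow> 'a" where
  "nc_sum a S = (\<Sum>\<sigma>\<in>NC_on S. nested_cumulant (semicircular_cumulant \<phi>) a \<sigma> S)"

lemma nc_sum_empty: "nc_sum a {} = 1"
  by (simp add: nc_sum_def NC_on_empty)

lemma nested_semicircular_first_pair:
  assumes j: "j \<in> {l<..<r}" and \<sigma>: "\<sigma>1 \<in> NC_on {l<..<j}" "\<sigma>2 \<in> NC_on {j<..<r}"
  shows "nested_cumulant (semicircular_cumulant \<phi>) a (insert {l, j} (\<sigma>1 \<union> \<sigma>2)) {l..<r} =
    \<phi> (a l * nested_cumulant (semicircular_cumulant \<phi>) a \<sigma>1 {l<..<j}) *\<^sub>C
      (a j * nested_cumulant (semicircular_cumulant \<phi>) a \<sigma>2 {j<..<r})"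
proof -
  let ?\<sigma> = "insert {l, j} (\<sigma>1 \<union> \<sigma>2)" and ?n = "nested_cumulant (semicircular_cumulant \<phi>) a"
  have \<sigma>': "partition_on {l..<r} ?\<sigma>"
    using bij_betwE[OF NC_on_first_pair[OF j]] \<sigma> by (auto simp: NC_on_def)
  have Min: "Min {l..<r} = l" using j by (intro Min_eqI) auto
  have V: "first_block ?\<sigma> {l..<r} = {l, j}"
    by (rule first_block_eq[OF \<sigma>']) (auto simp: Min)
  have gl: "gap {l..<r} {l, j} l = {l<..<j}" and gj: "gap {l..<r} {l, j} j = {j<..<r}"
    using j by (auto simp: gap_def)
  have s: "sorted_list_of_set {l, j} = [l, j]" using j by simp
  have s1: "W \<subseteq> {l<..<j}" if "W \<in> \<sigma>1" for W
    using \<sigma> that by (auto simp: NC_on_def partition_on_def)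
  have s2: "W \<subseteq> {j<..<r}" if "W \<in> \<sigma>2" for W
    using \<sigma> that by (auto simp: NC_on_def partition_on_def)
  \<comment> \<open>Neither the pair nor a block of the other gap contains a point of this
    gap.\<close>
  have 1: "?n ?\<sigma> {l<..<j} = ?n \<sigma>1 {l<..<j}"
    by (rule nested_cumulant_cong_on) (use s2 in fastforce)+
  have 2: "?n ?\<sigma> {j<..<r} = ?n \<sigma>2 {j<..<r}"
    by (rule nested_cumulant_cong_on) (use s1 j in fastforce)+
  show ?thesis
    using j by (subst nested_cumulant.simps) (simp add: V gl gj s 1 2 semicircular_cumulant_def)
qed

text \<open>Only partitions whose first block is a pair {l, j} contribute. The gap inside the pair
  ends up under the covariance \<phi>, the gap after it remains as a right factor.\<close>

lemma nc_sum_rec: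
  assumes lr: "l < r"
  shows "nc_sum a {l..<r} =
    (\<Sum>j\<in>{l<..<r}. \<phi> (a l * nc_sum a {l<..<j}) *\<^sub>C (a j * nc_sum a {j<..<r}))"
proof -
  let ?n = "nested_cumulant (semicircular_cumulant \<phi>) a"
  let ?P = "\<lambda>j. {\<sigma> \<in> NC_on {l..<r}. {l, j} \<in> \<sigma>}"
  have Min: "Min {l..<r} = l" using lr by (intro Min_eqI) auto
  have dis: "V = W" if "\<sigma> \<in> NC_on {l..<r}" "V \<in> \<sigma>" "W \<in> \<sigma>" "l \<in> V" "l \<in> W" for \<sigma> V W
    using that disjointD[OF partition_onD2[of "{l..<r}" \<sigma>], of V W] by (auto simp: NC_on_def)
  have zero: "?n \<sigma> {l..<r} = 0"
    if \<sigma>: "\<sigma> \<in> NC_on {l..<r} - (\<Union>j\<in>{l<..<r}. ?P j)" for \<sigma>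
  proof -
    have part: "partition_on {l..<r} \<sigma>" using \<sigma> by (simp add: NC_on_def)
    have "l \<in> \<Union>\<sigma>" using partition_onD1[OF part] lr by auto
    then obtain V where V: "V \<in> \<sigma>" "l \<in> V" by blast
    have fb: "first_block \<sigma> {l..<r} = V" by (rule first_block_eq[OF part]) (auto simp: V Min)
    have Vs: "V \<subseteq> {l..<r}" using V partition_onD1[OF part] by blast
    \<comment> \<open>A first block with two elements is {l, j} for some later j, which would put
      \<sigma> into the union excluded here.\<close>
    have "card V \<noteq> 2"
    proof
      assume "card V = 2"
      then obtain x z where xz: "V = {x, z}" "x \<noteq> z" by (auto simp: card_2_iff)
      then obtain j where j: "V = {l, j}" "j \<noteq> l" using V(2) by (cases "x = l") auto
      then have "j \<in> {l<..<r}" using Vs by auto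
      then show False using \<sigma> j V by auto
    qed
    then show ?thesis
      using lr by (subst nested_cumulant.simps) (simp add: fb semicircular_cumulant_length)
  qed
  have "nc_sum a {l..<r} = (\<Sum>\<sigma>\<in>(\<Union>j\<in>{l<..<r}. ?P j). ?n \<sigma> {l..<r})"
    unfolding nc_sum_def
    by (rule sum.mono_neutral_right) (use zero in \<open>auto intro: finite_NC_on\<close>)
  also have "\<dots> = (\<Sum>j\<in>{l<..<r}. \<Sum>\<sigma>\<in>?P j. ?n \<sigma> {l..<r})"
  proof (rule sum.UNION_disjoint)
    show "\<forall>i\<in>{l<..<r}. \<forall>j\<in>{l<..<r}. i \<noteq> j \<longrightarrow> ?P i \<inter> ?P j = {}"
      using dis by (fastforce simp: doubleton_eq_iff)
  qed (auto intro!: finite_subset[OF _ finite_NC_on[of "{l..<r}"]])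
  also have "\<dots> = (\<Sum>j\<in>{l<..<r}. \<phi> (a l * nc_sum a {l<..<j}) *\<^sub>C (a j * nc_sum a {j<..<r}))"
  proof (rule sum.cong)
    fix j assume j: "j \<in> {l<..<r}"
    have "(\<Sum>\<sigma>\<in>?P j. ?n \<sigma> {l..<r}) =
        (\<Sum>(\<sigma>1, \<sigma>2)\<in>NC_on {l<..<j} \<times> NC_on {j<..<r}. ?n (insert {l, j} (\<sigma>1 \<union> \<sigma>2)) {l..<r})"
      using sum.reindex_bij_betw[OF NC_on_first_pair[OF j], of "\<lambda>\<sigma>. ?n \<sigma> {l..<r}"]
      by (simp add: case_prod_unfold)
    also have "\<dots> = (\<Sum>(\<sigma>1, \<sigma>2)\<in>NC_on {l<..<j} \<times> NC_on {j<..<r}.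
        \<phi> (a l * ?n \<sigma>1 {l<..<j}) *\<^sub>C (a j * ?n \<sigma>2 {j<..<r}))"
      by (intro sum.cong refl) (auto simp: nested_semicircular_first_pair[OF j])
    also have "\<dots> = \<phi> (a l * nc_sum a {l<..<j}) *\<^sub>C (a j * nc_sum a {j<..<r})"
      by (simp add: nc_sum_def sum_distrib_left state_sum star_alg.scale_sum_right
          star_alg.scale_sum_left sum.cartesian_product[symmetric])
        (rule sum.swap)
    finally show "(\<Sum>\<sigma>\<in>?P j. ?n \<sigma> {l..<r}) =
      \<phi> (a l * nc_sum a {l<..<j}) *\<^sub>C (a j * nc_sum a {j<..<r})" .
  qed simp
  finally show ?thesis .
qed

end


subsection \<open>Wick products and the moments of a semicircular element\<close>

definition word :: "'a::monoid_mult \<Rightarrow> 'a list \<Rightarrow> 'a" where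
  "word X es = prod_list (map (\<lambda>e. X * e) es)"

lemma word_Nil [simp]: "word X [] = 1"
  and word_Cons: "word X (e # es) = X * e * word X es"
  and word_append: "word X (es @ fs) = word X es * word X fs"
  by (simp_all add: word_def)

context tracial_ncps
begin

text \<open>The subtracted term contracts the first two copies of \<open>X\<close> around
  \<open>e\<close>. The last entry stands behind all copies of \<open>X\<close>, so nothing is
  contracted around it.\<close>

fun wick :: "'a \<Rightarrow> 'a list \<Rightarrow> 'a" where
  "wick X [] = 1"
| "wick X [e] = X * e"
| "wick X (e # f # es) = X * e * wick X (f # es) - \<phi> e *\<^sub>C (f * wick X es)"

text \<open>When all inner entries are 1, the Wick recursion is the Chebyshev recurrence; the degree
  counts the k + 1 copies of \<open>X\<close>.\<close>

lemma wick_replicate: "wick X (replicate k 1 @ [e]) = cheb X (Suc k) * e"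
proof (induction k rule: induct_nat_012)
  case (ge2 k)
  then show ?case by (simp add: left_diff_distrib mult.assoc state_one scaleC_one)
qed (simp_all add: left_diff_distrib mult.assoc state_one scaleC_one)

text \<open>The only contraction linking the two halves goes around \<open>e\<close> and carries the
  factor \<phi> e = 0.\<close>

lemma wick_split:
  assumes "\<phi> e = 0"
  shows "wick X (es @ e # fs) = wick X (es @ [e]) * wick X fs"
proof (induction es rule: induct_list012)
  case 1
  show ?case using assms by (cases fs) auto
next
  case (2 f)
  show ?case using assms by (cases fs) (auto simp: left_diff_distrib mult.assoc mult_scaleC_left)
next
  case (3 f g es)
  then show ?case by (simp add: left_diff_distrib mult.assoc mult_scaleC_left)
qed

text \<open>Linearity in one entry; the induction looks two entries ahead, as the Wick recursion
  does.\<close>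

lemma wick_centre:
  "wick X (es @ e # fs) = \<phi> e *\<^sub>C wick X (es @ 1 # fs) + wick X (es @ (e - \<phi> e *\<^sub>C 1) # fs)"
proof (induction es rule: induct_list012)
  case 1
  show ?case
    by (cases fs) (auto simp: algebra_simps mult_scaleC_left mult_scaleC_right state_one
        state_diff state_scaleC scaleC_scaleC scaleC_one star_alg.scale_right_diff_distrib)
next
  case (2 f)
  have *: "wick X (e # fs) = \<phi> e *\<^sub>C wick X (1 # fs) + wick X ((e - \<phi> e *\<^sub>C 1) # fs)" for e
    by (cases fs) (auto simp: algebra_simps mult_scaleC_left mult_scaleC_right state_one
        state_diff state_scaleC scaleC_scaleC scaleC_one star_alg.scale_right_diff_distrib)
  show ?case
    by (simp add: *[of e] algebra_simps mult_scaleC_left mult_scaleC_right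
        scaleC_scaleC scaleC_one star_alg.scale_right_diff_distrib scaleC_add_right)
next
  case (3 f g es)
  show ?case
    unfolding append_Cons wick.simps
    unfolding "3.IH"(1) unfolding "3.IH"(2)[unfolded append_Cons]
    by (simp add: algebra_simps mult_scaleC_left mult_scaleC_right
        scaleC_scaleC star_alg.scale_right_diff_distrib scaleC_add_right)
qed

end

section \<open>Wick products of a semicircular element free from the diagonal\<close>

locale semicircular_free_from_diag = free_from_diag \<phi> d p A
  for \<phi> :: "'a::complex_star_algebra \<Rightarrow> complex" and d p and A :: "'k option \<Rightarrow> 'a set" +
  fixes s :: 'k and X :: 'a
  assumes X_in: "X \<in> A (Some s)" and X_semicircular: "semicircular \<phi> X"
begin

text \<open>The scalar part of the next entry lengthens the run of ones; its centred part closes the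
  run into one centred Chebyshev letter. Hence the generalisation over \<open>k\<close>.\<close>

lemma wick_replicate_in_span:
  assumes "set es \<subseteq> \<D>" "es \<noteq> []"
  shows "wick X (replicate k 1 @ es) \<in> star_alg.span {x. diag_word s x}"
  using assms
proof (induction es arbitrary: k)
  case (Cons e es)
  have e: "e \<in> \<D>" using Cons by simp
  have cheb: "cheb X (Suc k) \<in> A (Some s)" "\<phi> (cheb X (Suc k)) = 0"
    by (simp_all add: subalgebra_cheb[OF subalgebra X_in] state_cheb[OF X_semicircular])
  show ?case
  proof (cases "es = []")
    case True
    then show ?thesis
      using diag_last[OF cheb e] by (simp add: wick_replicate star_alg.span_base)
  next
    case False
    let ?e = "e - \<phi> e *\<^sub>C 1"
    have 1: "wick X (replicate k 1 @ 1 # es) \<in> star_alg.span {x. diag_word s x}"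
      using Cons.IH[of "Suc k"] Cons.prems False
      by (simp add: replicate_app_Cons_same)
    have w: "wick X es \<in> star_alg.span {x. diag_word s x}"
      using Cons.IH[of 0] Cons.prems False by simp
    have "wick X (replicate k 1 @ ?e # es) = cheb X (Suc k) * ?e * wick X es"
      by (subst wick_split[OF state_centred]) (simp only: wick_replicate)
    also have "\<dots> \<in> star_alg.span {x. diag_word s x}"
      using star_alg.span_base[of "cheb X (Suc k) * ?e" "{cheb X (Suc k) * ?e}"]
        w
    proof (rule span_mult)
      fix u x assume "u \<in> {cheb X (Suc k) * ?e}" "x \<in> {x. diag_word s x}"
      then have "diag_word s (u * x)"
        using diag_step[OF cheb diag_centred_in[OF e] state_centred] by simp
      then show "u * x \<in> star_alg.span {x. diag_word s x}" by (simp add: star_alg.span_base)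
    qed simp
    finally show ?thesis
      using 1 unfolding wick_centre[of X _ e]
      by (intro star_alg.span_add star_alg.span_scale)
  qed
qed simp

lemma state_diag_wick:
  assumes g: "g \<in> \<D>" and es: "set es \<subseteq> \<D>" "es \<noteq> []"
  shows "\<phi> (g * wick X es) = 0"
proof -
  have "wick X es \<in> star_alg.span {x. diag_word s x}"
    using wick_replicate_in_span[OF es, of 0] by simp
  then show ?thesis
  proof (induction rule: star_alg.span_induct_alt)
    case (step c x z)
    then show ?case
      using state_alt_word[OF diag_word_alt_word[of s x], of g] g diag_subset
      by (auto simp: distrib_left mult_scaleC_right state_add state_scaleC)
  qed simp
qed

text \<open>The index \<open>i\<close> is the letter with which the \<open>X\<close> in front of \<open>h\<close> gets paired.\<close>

lemma state_word_wick:
  assumes "set es \<subseteq> \<D>" "g \<in> \<D>" "set fs \<subseteq> \<D>" "h \<in> \<D>"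
  shows "\<phi> (word X es * g * wick X (fs @ [h])) =
    (\<Sum>i<length es. \<phi> (es ! i * word X (drop (Suc i) es) * g * wick X fs) * \<phi> (word X (take i es) * h))"
  using assms
\<comment> \<open>The last letter of the word moves into the Wick product, so \<open>g\<close> and
  \<open>fs\<close> must vary.\<close>
proof (induction es arbitrary: g fs rule: rev_induct)
  case Nil
  then show ?case by (simp add: state_diag_wick)
next
  case (snoc e es)
  have e: "e \<in> \<D>" "e * g \<in> \<D>" and es: "set es \<subseteq> \<D>" using snoc by (auto simp: diag_mult)
  have dr: "drop (Suc i) (es @ [e]) = drop (Suc i) es @ [e]" "take i (es @ [e]) = take i es"
    "(es @ [e]) ! i = es ! i" if "i < length es" for i using that by (auto simp: nth_append)
  have sum: "(\<Sum>i<length (es @ [e]). \<phi> ((es @ [e]) ! i * word X (drop (Suc i) (es @ [e])) * g * wick X fs) *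
        \<phi> (word X (take i (es @ [e])) * h)) =
      (\<Sum>i<length es. \<phi> (es ! i * word X (drop (Suc i) es) * (X * (e * g) * wick X fs)) *
        \<phi> (word X (take i es) * h)) + \<phi> (e * g * wick X fs) * \<phi> (word X es * h)"
    using dr by (simp add: word_append word_Cons mult.assoc)
  show ?case
  proof (cases fs)
    case Nil
    \<comment> \<open>Here the contraction reaches \<open>h\<close> and produces the last summand,
      the one for the letter \<open>e\<close>.\<close>
    have "X * (e * g) * wick X [h] = wick X [e * g, h] + \<phi> (e * g) *\<^sub>C h" by simp
    then have "\<phi> (word X (es @ [e]) * g * wick X (fs @ [h])) =
        \<phi> (word X es * 1 * wick X ([e * g] @ [h])) + \<phi> (e * g) * \<phi> (word X es * h)"
      by (simp add: Nil word_append word_Cons mult.assoc right_diff_distrib distrib_left state_add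
          mult_scaleC_right state_scaleC state_diff)
    also have "\<phi> (word X es * 1 * wick X ([e * g] @ [h])) =
        (\<Sum>i<length es. \<phi> (es ! i * word X (drop (Suc i) es) * 1 * wick X [e * g]) *
          \<phi> (word X (take i es) * h))"
      by (rule snoc.IH) (use es e snoc.prems diag_one in auto)
    finally show ?thesis unfolding sum by (simp add: Nil)
  next
    case (Cons f fs')
    have f: "f \<in> \<D>" "set fs' \<subseteq> \<D>" using snoc.prems Cons by auto
    have w: "X * (e * g) * wick X (f # us) = wick X ((e * g) # f # us) + \<phi> (e * g) *\<^sub>C (f * wick X us)" for us
      by simp
    have "\<phi> (word X (es @ [e]) * g * wick X (fs @ [h])) =
        \<phi> (word X es * (X * (e * g) * wick X (f # fs' @ [h])))"
      by (simp add: Cons word_append word_Cons mult.assoc)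
    also have "\<dots> = \<phi> (word X es * 1 * wick X (((e * g) # fs) @ [h])) +
        \<phi> (e * g) * \<phi> (word X es * f * wick X (fs' @ [h]))"
      unfolding w by (simp add: Cons distrib_left state_add mult_scaleC_right state_scaleC mult.assoc del: wick.simps)
    also have "\<phi> (word X es * 1 * wick X (((e * g) # fs) @ [h])) =
        (\<Sum>i<length es. \<phi> (es ! i * word X (drop (Suc i) es) * 1 * wick X ((e * g) # fs)) *
          \<phi> (word X (take i es) * h))"
      by (rule snoc.IH) (use es e snoc.prems diag_one in auto)
    also have "\<phi> (word X es * f * wick X (fs' @ [h])) =
        (\<Sum>i<length es. \<phi> (es ! i * word X (drop (Suc i) es) * f * wick X fs') *
          \<phi> (word X (take i es) * h))"
      by (rule snoc.IH) (use es f snoc.prems in auto)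
    \<comment> \<open>The summand for the letter \<open>e\<close> is zero: it contains \<phi>(e g
      W(fs)) with \<open>fs\<close> nonempty. The two induction hypotheses combine through
      \<open>w\<close>.\<close>
    finally show ?thesis
      unfolding sum unfolding Cons w
      using state_diag_wick[OF e(2), of "f # fs'"] f
      by (simp add: distrib_left state_add mult_scaleC_right state_scaleC distrib_right
          sum.distrib sum_distrib_left mult.assoc del: wick.simps)
  qed
qed

text \<open>The scalar Schwinger--Dyson equation. Traciality moves the leading \<open>X * e\<close>
  to the end, where it is a Wick product with one entry.\<close>

lemma state_word_rec:
  assumes "set es \<subseteq> \<D>" "e \<in> \<D>" "g \<in> \<D>"
  shows "\<phi> (word X (e # es) * g) =
    (\<Sum>i<length es. \<phi> (e * word X (take i es)) * \<phi> (es ! i * word X (drop (Suc i) es) * g))"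
proof -
  have "\<phi> (word X (e # es) * g) = \<phi> (word X es * g * wick X ([] @ [e]))"
    using state_trace[of "X * e" "word X es * g"] by (simp add: word_Cons mult.assoc)
  also have "\<dots> = (\<Sum>i<length es. \<phi> (es ! i * word X (drop (Suc i) es) * g) * \<phi> (word X (take i es) * e))"
    using assms by (subst state_word_wick) auto
  finally show ?thesis by (simp add: state_trace[of e] mult.commute)
qed

text \<open>Tested against \<open>\<D>\<close>, the Schwinger--Dyson equation becomes the recurrence
  \<open>nc_sum_rec\<close>, so both sides agree by induction on the length.\<close>

lemma cond_exp_word_eq_nc_sum:
  assumes a: "\<And>i. i \<in> {l..<r} \<Longrightarrow> a i \<in> \<D>"
  shows "\<E> (word X (map a [l..<r])) = nc_sum a {l..<r}"
  using a
proof (induction "r - l" arbitrary: l r rule: less_induct)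
  case less
  show ?case
  proof (cases "l < r")
    case False
    then show ?thesis by (simp add: nc_sum_empty cond_exp_diag diag_one)
  next
    case True
    have IH: "\<E> (word X (map a [l'..<r'])) = nc_sum a {l'..<r'}" if "l \<le> l'" "r' \<le> r" "r' - l' < r - l" for l' r'
      using less.hyps[OF that(3)] less.prems that by simp
    have ivl: "{i<..<j} = {Suc i..<j}" for i j by auto
    have IH1: "nc_sum a {l<..<j} = \<E> (word X (map a [Suc l..<j]))"
      and IH2: "nc_sum a {j<..<r} = \<E> (word X (map a [Suc j..<r]))" if "j \<in> {l<..<r}" for j
      using that IH[of "Suc l" j] IH[of "Suc j" r] by (auto simp: ivl)
    let ?es = "map a [Suc l..<r]"
    have al: "a l \<in> \<D>" and aj: "\<And>j. j \<in> {l<..<r} \<Longrightarrow> a j \<in> \<D>" using less.prems True by auto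
    have "\<E> (word X (map a [l..<r])) =
        (\<Sum>j\<in>{l<..<r}. \<phi> (a l * nc_sum a {l<..<j}) *\<^sub>C (a j * nc_sum a {j<..<r}))" (is "_ = ?R")
    proof (rule cond_exp_eqI)
      have "?R \<in> star_alg.span \<D>"
        by (intro star_alg.span_sum star_alg.span_scale star_alg.span_base diag_mult)
          (auto simp: aj IH2 cond_exp_in_diag)
      then show "?R \<in> \<D>" by (simp only: span_diag)
      fix g assume g: "g \<in> \<D>"
      have "\<phi> (word X (map a [l..<r]) * g) = \<phi> (word X (a l # ?es) * g)"
        using True by (simp add: upt_conv_Cons)
      also have "\<dots> = (\<Sum>i<r - Suc l. \<phi> (a l * word X (take i ?es)) *
          \<phi> (?es ! i * word X (drop (Suc i) ?es) * g))"
        by (subst state_word_rec) (use al aj g in auto)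
      \<comment> \<open>The offset i in the tail corresponds to the absolute position j = i + l +
        1.\<close>
      also have "\<dots> = (\<Sum>j\<in>{l<..<r}. \<phi> (a l * word X (map a [Suc l..<j])) *
          \<phi> (a j * word X (map a [Suc j..<r]) * g))"
        by (rule sum.reindex_bij_witness[of _ "\<lambda>j. j - Suc l" "\<lambda>i. i + Suc l"])
          (auto simp: take_map drop_map algebra_simps)
      \<comment> \<open>By induction each sum is \<E> of a word, and \<E> may be dropped under
        \<phi> against factors in \<open>\<D>\<close>.\<close>
      also have "\<dots> = (\<Sum>j\<in>{l<..<r}. \<phi> (a l * nc_sum a {l<..<j}) * \<phi> (a j * nc_sum a {j<..<r} * g))"
      proof (intro sum.cong refl)
        fix j assume j: "j \<in> {l<..<r}"
        have 1: "\<phi> (a l * nc_sum a {l<..<j}) = \<phi> (a l * word X (map a [Suc l..<j]))"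
          using state_cond_exp[OF al, of "word X (map a [Suc l..<j])"]
          by (simp add: IH1[OF j] state_trace[of "a l"])
        have "\<phi> (a j * nc_sum a {j<..<r} * g) = \<phi> (a j * word X (map a [Suc j..<r]) * g)"
          using state_cond_exp[OF diag_mult[OF g aj[OF j]], of "word X (map a [Suc j..<r])"]
          by (simp add: IH2[OF j] mult.assoc state_trace[of "a j"])
        with 1 show "\<phi> (a l * word X (map a [Suc l..<j])) * \<phi> (a j * word X (map a [Suc j..<r]) * g) =
          \<phi> (a l * nc_sum a {l<..<j}) * \<phi> (a j * nc_sum a {j<..<r} * g)" by simp
      qed
      also have "\<dots> = \<phi> (?R * g)"
        by (simp add: sum_distrib_right state_sum mult_scaleC_left state_scaleC)
      finally show "\<phi> (word X (map a [l..<r]) * g) = \<phi> (?R * g)" .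
    qed
    then show ?thesis using True by (simp only: nc_sum_rec)
  qed
qed

lemma cond_exp_word:
  assumes "set es \<subseteq> \<D>"
  shows "\<E> (word X es) = (\<Sum>\<sigma>\<in>NC (length es).
    nested_cumulant (semicircular_cumulant \<phi>) (\<lambda>i. es ! i) \<sigma> {..<length es})"
proof -
  have "\<E> (word X (map ((!) es) [0..<length es])) = nc_sum ((!) es) {0..<length es}"
    using assms by (intro cond_exp_word_eq_nc_sum) auto
  then show ?thesis by (simp add: map_nth nc_sum_def NC_eq_NC_on atLeast0LessThan)
qed

section \<open>Operator-valued cumulants and the distribution\<close>

lemma semicircular_cumulant_in_diag:
  "set es \<subseteq> \<D> \<Longrightarrow> semicircular_cumulant \<phi> es \<in> \<D>"
  using diag_scale[OF diag_one, of 0]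
  by (auto simp: semicircular_cumulant_def diag_scale split: list.split)

text \<open>The value of each gap lies in \<open>\<D>\<close> and merges with the entry before it,
  so every block is again evaluated on letters \<open>X * e\<close>. Membership in
  \<open>\<D>\<close> is therefore carried through the induction.\<close>

lemma nested_cumulant_word:
  assumes "\<And>es. set es \<subseteq> \<D> \<Longrightarrow> es \<noteq> [] \<Longrightarrow> length es < n \<Longrightarrow>
      c (map (\<lambda>e. X * e) es) = semicircular_cumulant \<phi> es"
    and "\<And>T. T \<subseteq> S \<Longrightarrow> T \<noteq> {} \<Longrightarrow> first_block \<sigma> T \<noteq> {} \<and> card (first_block \<sigma> T) < n"
    and "finite S" "\<And>i. i \<in> S \<Longrightarrow> a i \<in> \<D>"
  shows "nested_cumulant c (\<lambda>i. X * a i) \<sigma> S = nested_cumulant (semicircular_cumulant \<phi>) a \<sigma> S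
    \<and> nested_cumulant (semicircular_cumulant \<phi>) a \<sigma> S \<in> \<D>"
  using assms(2-)
proof (induction "card S" arbitrary: S rule: less_induct)
  case less
  let ?V = "first_block \<sigma> S" and ?m = "nested_cumulant c (\<lambda>i. X * a i) \<sigma>"
    and ?n = "nested_cumulant (semicircular_cumulant \<phi>) a \<sigma>"
  show ?case
  proof (cases "S = {}")
    case False
    then have S: "(finite S \<and> S \<noteq> {}) = True" using less.prems(2) by simp
    have fin: "finite ?V" using less.prems(2) first_block_subset finite_subset by blast
    have IH: "?m (gap S ?V v) = ?n (gap S ?V v)" "?n (gap S ?V v) \<in> \<D>" if "v \<in> ?V" for v
    proof -
      have ps: "gap S ?V v \<subset> S" using that first_block_subset by (intro gap_psubset) blast
      have "?m (gap S ?V v) = ?n (gap S ?V v) \<and> ?n (gap S ?V v) \<in> \<D>"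
      proof (rule less.hyps)
        show "card (gap S ?V v) < card S" using ps less.prems(2) by (simp add: psubset_card_mono)
        show "first_block \<sigma> T \<noteq> {} \<and> card (first_block \<sigma> T) < n"
          if "T \<subseteq> gap S ?V v" "T \<noteq> {}" for T
          using that ps by (intro less.prems(1)) auto
        show "finite (gap S ?V v)" using ps less.prems(2) by (meson finite_subset psubset_imp_subset)
      qed (use ps less.prems(3) in blast)
      then show "?m (gap S ?V v) = ?n (gap S ?V v)" "?n (gap S ?V v) \<in> \<D>" by auto
    qed
    let ?es = "map (\<lambda>v. a v * ?n (gap S ?V v)) (sorted_list_of_set ?V)"
    have es: "set ?es \<subseteq> \<D>" using fin IH(2) less.prems(3) first_block_subset[of \<sigma> S] by (auto intro!: diag_mult)
    have "map (\<lambda>v. X * a v * ?m (gap S ?V v)) (sorted_list_of_set ?V) = map (\<lambda>e. X * e) ?es"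
      using fin by (simp add: IH(1) mult.assoc)
    then have "?m S = c (map (\<lambda>e. X * e) ?es)"
      by (subst nested_cumulant.simps) (simp only: S if_True)
    also have "\<dots> = semicircular_cumulant \<phi> ?es"
      using less.prems(1)[of S] False fin by (intro assms(1) es) auto
    also have n: "semicircular_cumulant \<phi> ?es = ?n S"
      by (subst (2) nested_cumulant.simps) (simp only: S if_True)
    finally show ?thesis using semicircular_cumulant_in_diag[OF es] by (simp only: n simp_thms)
  qed (simp add: diag_one)
qed

text \<open>By induction, partitions with more than one block contribute equally to the cumulant
  recursion and to the moment formula \<open>cond_exp_word\<close>; the one-block terms must then
  agree.\<close>

lemma cumulant_word:
  assumes "set es \<subseteq> \<D>" "es \<noteq> []"
  shows "cumulant \<E> (map (\<lambda>e. X * e) es) = semicircular_cumulant \<phi> es"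
  using assms
proof (induction "length es" arbitrary: es rule: less_induct)
  case less
  let ?n = "length es" and ?as = "map (\<lambda>e. X * e) es"
  let ?s = "\<lambda>\<sigma>. nested_cumulant (semicircular_cumulant \<phi>) (\<lambda>i. es ! i) \<sigma> {..<?n}"
  have "nested_cumulant (cumulant \<E>) (\<lambda>i. ?as ! i) \<sigma> {..<?n} = ?s \<sigma>"
    if \<sigma>: "\<sigma> \<in> NC ?n - {{{..<?n}}}" for \<sigma>
  proof -
    have part: "partition_on {..<?n} \<sigma>" using \<sigma> by (simp add: NC_def)
    have "nested_cumulant (cumulant \<E>) (\<lambda>i. ?as ! i) \<sigma> {..<?n} =
        nested_cumulant (cumulant \<E>) (\<lambda>i. X * es ! i) \<sigma> {..<?n}"
      by (rule nested_cumulant_cong_on) auto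
    also have "\<dots> = ?s \<sigma>"
    proof (rule nested_cumulant_word[THEN conjunct1])
      fix T assume T: "T \<subseteq> {..<?n}" "T \<noteq> {}"
      have "Min T \<in> T" using T finite_subset by (intro Min_in) auto
      moreover have "T \<subseteq> \<Union>\<sigma>" using T part by (auto simp: partition_on_def)
      ultimately have "Min T \<in> first_block \<sigma> T" by (auto simp: first_block_def)
      then show "first_block \<sigma> T \<noteq> {} \<and> card (first_block \<sigma> T) < ?n"
        using partition_on_first_block[of "{..<?n}" \<sigma> T] \<sigma> T by (auto simp: NC_def)
    qed (use less in auto)
    finally show ?thesis .
  qed
  then have "cumulant \<E> ?as = \<E> (word X es) - (\<Sum>\<sigma>\<in>NC ?n - {{{..<?n}}}. ?s \<sigma>)"
    by (subst cumulant.simps) (simp add: word_def)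
  also have "\<E> (word X es) = ?s {{..<?n}} + (\<Sum>\<sigma>\<in>NC ?n - {{{..<?n}}}. ?s \<sigma>)"
    unfolding cond_exp_word[OF less.prems(1)]
    using less.prems(2) by (intro sum.remove finite_NC one_block_NC) simp
  also have "?s {{..<?n}} = semicircular_cumulant \<phi> es"
    using less.prems(2) by (rule nested_cumulant_one_block)
  finally show ?case by simp
qed

lemma diag_semicircular: "diag_semicircular \<phi> d p X"
  unfolding diag_semicircular_def
proof (intro conjI ballI allI impI)
  show "star X = X" using X_semicircular by (simp add: semicircular_def)
  \<comment> \<open>Here and in the next claim, a bare \<open>X\<close> is read as X times the unit
    of \<open>\<D>\<close>.\<close>
  show "cumulant \<E> [X] = 0"
    using cumulant_word[of "[1]"] by (simp add: diag_one semicircular_cumulant_def)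
  show "cumulant \<E> [X * e, X] = \<phi> e *\<^sub>C 1" if "e \<in> \<D>" for e
    using cumulant_word[of "[e, 1]"] that by (simp add: diag_one semicircular_cumulant_def)
  show "cumulant \<E> (map (\<lambda>e. X * e) es) = 0" if "3 \<le> length es \<and> set es \<subseteq> \<D>" for es
    using that by (subst cumulant_word) (auto simp: semicircular_cumulant_length)
qed

lemma diag_distribution_eq:
  "diag_distribution \<phi> d p (\<lambda>_::unit. X) = diag_semicircular_distribution \<phi> d p"
  unfolding diag_distribution_def diag_semicircular_distribution_def
proof (rule restrict_ext)
  fix w :: "(unit \<times> bool \<times> 'a) list" assume w: "w \<in> diag_words d p"
  let ?es = "map (\<lambda>t. snd (snd t)) w"
  have star: "star X = X" using X_semicircular by (simp add: semicircular_def)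
  have "prod_list (map (\<lambda>(i, \<epsilon>, e). (if \<epsilon> then star X else X) * e) w) = word X ?es"
    by (simp add: word_def star o_def case_prod_unfold cong: if_cong)
  moreover have "set ?es \<subseteq> \<D>" using w by (auto simp: diag_words_def)
  moreover have "nested_cumulant (semicircular_cumulant \<phi>) (\<lambda>i. ?es ! i) \<sigma> {..<length w} =
      nested_cumulant (semicircular_cumulant \<phi>) (\<lambda>i. snd (snd (w ! i))) \<sigma> {..<length w}" for \<sigma>
    by (rule nested_cumulant_cong_on) auto
  ultimately show "\<E> (prod_list (map (\<lambda>(i, \<epsilon>, e). (if \<epsilon> then star X else X) * e) w)) =
      (\<Sum>\<sigma>\<in>NC (length w). nested_cumulant (semicircular_cumulant \<phi>) (\<lambda>i. snd (snd (w ! i))) \<sigma> {..<length w})"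
    using cond_exp_word[of ?es] by simp
qed

end

theorem theorem3p3:
  fixes \<phi> :: "'a::complex_star_algebra \<Rightarrow> complex"
    and d :: nat
    and p :: "nat \<Rightarrow> 'a"
    and y :: "nat \<Rightarrow> 'a"
    and B :: "'a set"
  assumes space: "projected_tracial_ncps \<phi> d p"
    and semicirc: "\<And>s. semicircular \<phi> (y s)"
    and subalg: "unital_subalgebra B"
    and contains: "diag d p \<subseteq> B"
    and free: "free_family \<phi> (case_option B (\<lambda>s. {y s}))"
  shows "amalgamated_free_family \<phi> d p (case_option B (\<lambda>s. {y s}))
    \<and> (\<forall>s. diag_semicircular \<phi> d p (y s)
          \<and> diag_distribution \<phi> d p (\<lambda>_::unit. y s) = diag_semicircular_distribution \<phi> d p)"
proof -
  obtain A where A: "\<And>k. unital_subalgebra (A k)" "\<And>k. case_option B (\<lambda>s. {y s}) k \<subseteq> A k"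
    "alternating_vanish \<phi> A"
    using free unfolding free_family_def by blast
  interpret projected_tracial_ncps \<phi> d p by (rule space)
  \<comment> \<open>The algebra at \<open>None\<close> is the one witnessing freeness; it contains
    \<open>B\<close> and hence \<open>\<D>\<close>.\<close>
  interpret free_from_diag \<phi> d p A
    by unfold_locales (use A A(2)[of None] contains in auto)
  show ?thesis
  proof (intro conjI allI)
    show "amalgamated_free_family \<phi> d p (case_option B (\<lambda>s. {y s}))"
      by (rule amalgamated_free) (rule A(2))
    fix s
    interpret semicircular_free_from_diag \<phi> d p A s "y s"
      by unfold_locales (use A(2)[of "Some s"] semicirc in auto)
    show "diag_semicircular \<phi> d p (y s)" by (rule diag_semicircular)
    show "diag_distribution \<phi> d p (\<lambda>_::unit. y s) = diag_semicircular_distribution \<phi> d p"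
      by (rule diag_distribution_eq)
  qed
qed

end
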